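(* Let $(K,q,\mathcal G)$ be a groupoid action by a topologically ergodic groupoid $\mathcal G$. Then the following assertions are equivalent. (i) $(K,q,\mathcal G)$ is pseudoisometric. (ii) The uniform enveloping semigroupoid $\mathcal E_{\mathrm u}(K,q,\mathcal G)$ is a compact groupoid.
   Context: All compact spaces are Hausdorff. A groupoid $\mathcal G$ has source $s(g)=g^{-1}g$, range $r(g)=gg^{-1}$, unit space $\mathcal G^{(0)}$; $gh$ is defined iff $s(g)=r(h)$. A topological groupoid carries a Hausdorff topology making product and inversion continuous. A groupoid action $(K,q,\mathcal G)$ of a topological groupoid $\mathcal G$ on a compact space $K$ consists of a continuous open surjection $q\colon K\to\mathcal G^{(0)}$ (so $\mathcal G^{(0)}$ is compact) and a continuous map $\varphi\colon\{(g,x)\in\mathcal G\times K: s(g)=q(x)\}\to K$, $(g,x)\mapsto\varphi_g(x)=gx$, with $q(gx)=r(g)$, $(g_1g_2)x=g_1(g_2x)$ whenever defined, and $ux=x$ for $u\in\mathcal G^{(0)}$, $x\in K_u:=q^{-1}(u)$. Thus $\varphi_g\colon K_{s(g)}\to K_{r(g)}$. A topological groupoid $\mathcal G$ with compact unit space is topologically ergodic if, whenever $\pi\colon\mathcal G^{(0)}\to M$ is a continuous surjection onto a compact space with $\pi(s(g))=\pi(r(g))$ for all $g\in\mathcal G$, $M$ is a point. (Equivalently: every $f\in\mathrm C(\mathcal G^{(0)})$ with $f\circ s=f\circ r$ is constant.) The action is pseudoisometric if there is a set $P$ of continuous maps $p\colon\{(x,y)\in K\times K:q(x)=q(y)\}\to[0,\infty)$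 such that for every $u\in\mathcal G^{(0)}$ each $p|_{K_u\times K_u}$ ($p\in P$) is a pseudometric, these pseudometrics generate the topology of $K_u$, and $p(gx,gy)=p(x,y)$ for all $p\in P$, $g\in\mathcal G$, $x,y\in K_{s(g)}$. $\mathrm C_q^q(K,K)=\bigcup_{u,v\in\mathcal G^{(0)}}\mathrm C(K_u,K_v)$ with $s(\theta)=u$, $r(\theta)=v$ for $\theta\in\mathrm C(K_u,K_v)$, is a semigroupoid under composition $\theta\circ\eta$ (defined when $r(\eta)=s(\theta)$), with the compact-open topology generated by the sets $\{\theta:\theta(C\cap K_{s(\theta)})\subset O\}$, $C\subset K$ compact, $O\subset K$ open. $\mathcal E_{\mathrm u}(K,q,\mathcal G)$ is the smallest closed subset of $\mathrm C_q^q(K,K)$ that is closed under all defined compositions and contains all $\varphi_g\colon K_{s(g)}\to K_{r(g)}$, $g\in\mathcal G$. It is a compact groupoid if it is compact, every element $\theta$ is bijective with $\theta^{-1}\in\mathcal E_{\mathrm u}(K,q,\mathcal G)$, and inversion is continuous. *)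

theory Defs
  imports "HOL-Analysis.Analysis"
begin

section \<open>Topological groupoids\<close>

record 'g groupoid_data =
  gtop :: "'g topology"
  gmult :: "'g \<Rightarrow> 'g \<Rightarrow> 'g"
  ginv :: "'g \<Rightarrow> 'g"

text \<open>The elements of the groupoid are the points of its topology. Multiplication is a total
  function whose values matter only on the composable pairs.\<close>

definition garrows :: "'g groupoid_data \<Rightarrow> 'g set" where
  "garrows G = topspace (gtop G)"

definition gsrc :: "'g groupoid_data \<Rightarrow> 'g \<Rightarrow> 'g" where
  "gsrc G g = gmult G (ginv G g) g"

definition grng :: "'g groupoid_data \<Rightarrow> 'g \<Rightarrow> 'g" where
  "grng G g = gmult G g (ginv G g)"

definition gunits :: "'g groupoid_data \<Rightarrow> 'g set" where
  "gunits G = gsrc G ` garrows G"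

definition unit_space :: "'g groupoid_data \<Rightarrow> 'g topology" where
  "unit_space G = subtopology (gtop G) (gunits G)"

locale groupoid =
  fixes G :: "'g groupoid_data"
  assumes inv_closed: "g \<in> garrows G \<Longrightarrow> ginv G g \<in> garrows G"
    and inv_inv: "g \<in> garrows G \<Longrightarrow> ginv G (ginv G g) = g"
    and mult_closed: "\<lbrakk>g \<in> garrows G; h \<in> garrows G; gsrc G g = grng G h\<rbrakk>
      \<Longrightarrow> gmult G g h \<in> garrows G"
    and src_mult: "\<lbrakk>g \<in> garrows G; h \<in> garrows G; gsrc G g = grng G h\<rbrakk>
      \<Longrightarrow> gsrc G (gmult G g h) = gsrc G h"
    and rng_mult: "\<lbrakk>g \<in> garrows G; h \<in> garrows G; gsrc G g = grng G h\<rbrakk>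
      \<Longrightarrow> grng G (gmult G g h) = grng G g"
    and mult_assoc: "\<lbrakk>g \<in> garrows G; h \<in> garrows G; k \<in> garrows G;
        gsrc G g = grng G h; gsrc G h = grng G k\<rbrakk>
      \<Longrightarrow> gmult G (gmult G g h) k = gmult G g (gmult G h k)"
    and rng_unit: "g \<in> garrows G \<Longrightarrow> gmult G (grng G g) g = g"
    and src_unit: "g \<in> garrows G \<Longrightarrow> gmult G g (gsrc G g) = g"

locale topological_groupoid = groupoid G for G :: "'g groupoid_data" +
  assumes Hausdorff: "Hausdorff_space (gtop G)"
    and continuous_mult:
      "continuous_map (subtopology (prod_topology (gtop G) (gtop G)) {(g, h). gsrc G g = grng G h})
         (gtop G) (\<lambda>(g, h). gmult G g h)"
    and continuous_inv: "continuous_map (gtop G) (gtop G) (ginv G)"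

text \<open>Compact spaces are Hausdorff by convention. The space \<open>M\<close> ranges over topologies on the
  type of the groupoid; since \<open>M\<close> is an image of the unit space, this loses no generality, see
  \<open>topologically_ergodic_any_type\<close> below.\<close>

definition topologically_ergodic :: "'g groupoid_data \<Rightarrow> bool" where
  "topologically_ergodic G \<longleftrightarrow>
     topological_groupoid G \<and> compact_space (unit_space G) \<and>
     (\<forall>(M :: 'g topology) \<pi>.
        compact_space M \<and> Hausdorff_space M \<and>
        continuous_map (unit_space G) M \<pi> \<and> \<pi> ` topspace (unit_space G) = topspace M \<and>
        (\<forall>g\<in>garrows G. \<pi> (gsrc G g) = \<pi> (grng G g))
        \<longrightarrow> (\<exists>m. topspace M = {m}))"

section \<open>Groupoid actions\<close>

definition fibre :: "'k topology \<Rightarrow> ('k \<Rightarrow> 'g) \<Rightarrow> 'g \<Rightarrow> 'k set" where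
  "fibre K q u = {x \<in> topspace K. q x = u}"

definition fibre_space :: "'k topology \<Rightarrow> ('k \<Rightarrow> 'g) \<Rightarrow> 'g \<Rightarrow> 'k topology" where
  "fibre_space K q u = subtopology K (fibre K q u)"

locale groupoid_action = topological_groupoid G
  for K :: "'k topology" and q :: "'k \<Rightarrow> 'g" and G :: "'g groupoid_data"
    and act :: "'g \<Rightarrow> 'k \<Rightarrow> 'k" +
  assumes compact_K: "compact_space K"
    and Hausdorff_K: "Hausdorff_space K"
    and continuous_q: "continuous_map K (unit_space G) q"
    and open_q: "open_map K (unit_space G) q"
    and surj_q: "q ` topspace K = topspace (unit_space G)"
    and continuous_act:
      "continuous_map (subtopology (prod_topology (gtop G) K) {(g, x). gsrc G g = q x})
         K (\<lambda>(g, x). act g x)"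
    and q_act: "\<lbrakk>g \<in> garrows G; x \<in> topspace K; gsrc G g = q x\<rbrakk> \<Longrightarrow> q (act g x) = grng G g"
    and act_mult: "\<lbrakk>g \<in> garrows G; h \<in> garrows G; x \<in> topspace K; gsrc G g = grng G h; gsrc G h = q x\<rbrakk>
      \<Longrightarrow> act (gmult G g h) x = act g (act h x)"
    and act_unit: "\<lbrakk>u \<in> gunits G; x \<in> fibre K q u\<rbrakk> \<Longrightarrow> act u x = x"

section \<open>Pseudoisometric actions\<close>

definition pseudometric_on :: "'a set \<Rightarrow> ('a \<times> 'a \<Rightarrow> real) \<Rightarrow> bool" where
  "pseudometric_on X d \<longleftrightarrow>
     (\<forall>x\<in>X. \<forall>y\<in>X. 0 \<le> d (x, y)) \<and>
     (\<forall>x\<in>X. d (x, x) = 0) \<and>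
     (\<forall>x\<in>X. \<forall>y\<in>X. d (x, y) = d (y, x)) \<and>
     (\<forall>x\<in>X. \<forall>y\<in>X. \<forall>z\<in>X. d (x, z) \<le> d (x, y) + d (y, z))"

text \<open>The whole set \<open>X\<close> is added to the subbase because \<open>topology_generated_by\<close> does not
  include the empty intersection; this only matters if \<open>P\<close> is empty.\<close>

definition pseudometric_topology :: "'a set \<Rightarrow> ('a \<times> 'a \<Rightarrow> real) set \<Rightarrow> 'a topology" where
  "pseudometric_topology X P =
     topology_generated_by
       (insert X {{y \<in> X. p (x, y) < \<epsilon>} | p x \<epsilon>. p \<in> P \<and> x \<in> X \<and> 0 < \<epsilon>})"

definition pseudoisometric ::
    "'k topology \<Rightarrow> ('k \<Rightarrow> 'g) \<Rightarrow> 'g groupoid_data \<Rightarrow> ('g \<Rightarrow> 'k \<Rightarrow> 'k) \<Rightarrow> bool" where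
  "pseudoisometric K q G act \<longleftrightarrow>
     (\<exists>P :: ('k \<times> 'k \<Rightarrow> real) set.
        (\<forall>p\<in>P. continuous_map (subtopology (prod_topology K K) {(x, y). q x = q y})
                  (top_of_set {0..}) p) \<and>
        (\<forall>u\<in>gunits G. \<forall>p\<in>P. pseudometric_on (fibre K q u) p) \<and>
        (\<forall>u\<in>gunits G. pseudometric_topology (fibre K q u) P = fibre_space K q u) \<and>
        (\<forall>p\<in>P. \<forall>g\<in>garrows G. \<forall>x\<in>fibre K q (gsrc G g). \<forall>y\<in>fibre K q (gsrc G g).
            p (act g x, act g y) = p (x, y)))"

section \<open>The uniform enveloping semigroupoid\<close>

text \<open>A map between fibres is recorded with its source and range units; the underlying function
  is made \<open>undefined\<close> outside the source fibre so that equality is equality of maps.\<close>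

datatype ('g, 'k) fibre_map = Fibre_Map (fsrc: 'g) (frng: 'g) (ffun: "'k \<Rightarrow> 'k")

definition fibre_maps ::
    "'k topology \<Rightarrow> ('k \<Rightarrow> 'g) \<Rightarrow> 'g groupoid_data \<Rightarrow> ('g, 'k) fibre_map set" where
  "fibre_maps K q G =
     (\<Union>u\<in>gunits G. \<Union>v\<in>gunits G.
        {Fibre_Map u v f | f. f \<in> extensional (fibre K q u) \<and>
            continuous_map (fibre_space K q u) (fibre_space K q v) f})"

definition fibre_comp ::
    "'k topology \<Rightarrow> ('k \<Rightarrow> 'g) \<Rightarrow> ('g, 'k) fibre_map \<Rightarrow> ('g, 'k) fibre_map \<Rightarrow> ('g, 'k) fibre_map" where
  "fibre_comp K q \<theta> \<eta> =
     Fibre_Map (fsrc \<eta>) (frng \<theta>) (compose (fibre K q (fsrc \<eta>)) (ffun \<theta>) (ffun \<eta>))"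

definition fibre_inverse ::
    "'k topology \<Rightarrow> ('k \<Rightarrow> 'g) \<Rightarrow> ('g, 'k) fibre_map \<Rightarrow> ('g, 'k) fibre_map" where
  "fibre_inverse K q \<theta> =
     Fibre_Map (frng \<theta>) (fsrc \<theta>)
       (restrict (inv_into (fibre K q (fsrc \<theta>)) (ffun \<theta>)) (fibre K q (frng \<theta>)))"

definition act_map ::
    "'k topology \<Rightarrow> ('k \<Rightarrow> 'g) \<Rightarrow> 'g groupoid_data \<Rightarrow> ('g \<Rightarrow> 'k \<Rightarrow> 'k) \<Rightarrow> 'g \<Rightarrow> ('g, 'k) fibre_map" where
  "act_map K q G act g =
     Fibre_Map (gsrc G g) (grng G g) (restrict (act g) (fibre K q (gsrc G g)))"

definition compact_open_topology ::
    "'k topology \<Rightarrow> ('k \<Rightarrow> 'g) \<Rightarrow> 'g groupoid_data \<Rightarrow> ('g, 'k) fibre_map topology" where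
  "compact_open_topology K q G =
     topology_generated_by
       {{\<theta> \<in> fibre_maps K q G. ffun \<theta> ` (C \<inter> fibre K q (fsrc \<theta>)) \<subseteq> U} | C U.
          compactin K C \<and> openin K U}"

definition enveloping_candidate ::
    "'k topology \<Rightarrow> ('k \<Rightarrow> 'g) \<Rightarrow> 'g groupoid_data \<Rightarrow> ('g \<Rightarrow> 'k \<Rightarrow> 'k) \<Rightarrow>
     ('g, 'k) fibre_map set \<Rightarrow> bool" where
  "enveloping_candidate K q G act S \<longleftrightarrow>
     closedin (compact_open_topology K q G) S \<and>
     (\<forall>\<theta>\<in>S. \<forall>\<eta>\<in>S. frng \<eta> = fsrc \<theta> \<longrightarrow> fibre_comp K q \<theta> \<eta> \<in> S) \<and>
     (\<forall>g\<in>garrows G. act_map K q G act g \<in> S)"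

definition uniform_enveloping_semigroupoid ::
    "'k topology \<Rightarrow> ('k \<Rightarrow> 'g) \<Rightarrow> 'g groupoid_data \<Rightarrow> ('g \<Rightarrow> 'k \<Rightarrow> 'k) \<Rightarrow> ('g, 'k) fibre_map set" where
  "uniform_enveloping_semigroupoid K q G act = \<Inter> {S. enveloping_candidate K q G act S}"

definition is_compact_groupoid ::
    "'k topology \<Rightarrow> ('k \<Rightarrow> 'g) \<Rightarrow> 'g groupoid_data \<Rightarrow> ('g, 'k) fibre_map set \<Rightarrow> bool" where
  "is_compact_groupoid K q G S \<longleftrightarrow>
     (let T = subtopology (compact_open_topology K q G) S in
        compact_space T \<and> Hausdorff_space T \<and>
        (\<forall>\<theta>\<in>S. bij_betw (ffun \<theta>) (fibre K q (fsrc \<theta>)) (fibre K q (frng \<theta>)) \<and>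
                fibre_inverse K q \<theta> \<in> S) \<and>
        continuous_map T T (fibre_inverse K q))"

section \<open>Consistency of the encodings\<close>

lemma topologically_ergodic_any_type:
  fixes G :: "'g groupoid_data" and M :: "'m topology"
  assumes erg: "topologically_ergodic G"
    and M: "compact_space M" "Hausdorff_space M"
    and cont: "continuous_map (unit_space G) M \<pi>"
    and surj: "\<pi> ` topspace (unit_space G) = topspace M"
    and inv: "\<And>g. g \<in> garrows G \<Longrightarrow> \<pi> (gsrc G g) = \<pi> (grng G g)"
  shows "\<exists>m. topspace M = {m}"
proof -
  define j where "j = inv_into (topspace (unit_space G)) \<pi>"
  have pj: "\<pi> (j m) = m" if "m \<in> topspace M" for m
    using that surj unfolding j_def by (simp add: f_inv_into_f)
  define N where "N = pullback_topology (j ` topspace M) \<pi> M"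
  have tN: "topspace N = j ` topspace M"
    unfolding N_def topspace_pullback_topology using pj by auto
  have c1: "continuous_map N M \<pi>"
    unfolding N_def using continuous_map_pullback[of M M id] by simp
  have c2: "continuous_map M N j"
    unfolding N_def
  proof (rule continuous_map_pullback')
    show "continuous_map M M (\<pi> \<circ> j)"
      by (rule continuous_map_eq[OF continuous_map_id]) (simp add: pj)
  qed auto
  have hom: "homeomorphic_maps M N j \<pi>"
    unfolding homeomorphic_maps_def using c1 c2 pj tN by auto
  then have "M homeomorphic_space N"
    unfolding homeomorphic_space_def by blast
  then have "compact_space N" "Hausdorff_space N"
    using M homeomorphic_compact_space homeomorphic_Hausdorff_space by blast+
  moreover have "continuous_map (unit_space G) N (j \<circ> \<pi>)"
    using cont c2 continuous_map_compose by blast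
  moreover have "(j \<circ> \<pi>) ` topspace (unit_space G) = topspace N"
    using surj tN by (metis image_comp)
  ultimately obtain n where "topspace N = {n}"
    using erg inv unfolding topologically_ergodic_def by (metis comp_apply)
  then have "topspace M = {\<pi> n}"
    using tN pj by (metis (no_types, lifting) image_empty image_insert image_cong image_ident image_image)
  then show ?thesis by blast
qed

lemma topspace_compact_open_topology [simp]:
  "topspace (compact_open_topology K q G) = fibre_maps K q G"
proof -
  have "fibre_maps K q G \<in> {{\<theta> \<in> fibre_maps K q G. ffun \<theta> ` (C \<inter> fibre K q (fsrc \<theta>)) \<subseteq> U} | C U.
          compactin K C \<and> openin K U}"
    by (rule CollectI, rule exI[of _ "{}"], rule exI[of _ "{}"]) auto
  then show ?thesis
    unfolding compact_open_topology_def topology_generated_by_topspace by blast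
qed

lemma topspace_pseudometric_topology [simp]: "topspace (pseudometric_topology X P) = X"
  unfolding pseudometric_topology_def topology_generated_by_topspace by auto

lemma (in groupoid) grng_in_gunits: "g \<in> garrows G \<Longrightarrow> grng G g \<in> gunits G"
  unfolding gunits_def using inv_closed inv_inv
  by (intro image_eqI[of _ _ "ginv G g"]) (auto simp: gsrc_def grng_def)

lemma (in groupoid_action) act_map_in_fibre_maps:
  assumes g: "g \<in> garrows G"
  shows "act_map K q G act g \<in> fibre_maps K q G"
proof -
  let ?Ku = "fibre K q (gsrc G g)"
  have c: "continuous_map (fibre_space K q (gsrc G g))
      (subtopology (prod_topology (gtop G) K) {(g, x). gsrc G g = q x}) (\<lambda>x. (g, x))"
    unfolding continuous_map_in_subtopology
  proof
    show "continuous_map (fibre_space K q (gsrc G g)) (prod_topology (gtop G) K) (\<lambda>x. (g, x))"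
      unfolding continuous_map_paired fibre_space_def
      using g by (auto simp: garrows_def intro: continuous_map_from_subtopology)
  qed (auto simp: fibre_space_def fibre_def)
  have "continuous_map (fibre_space K q (gsrc G g)) K (act g)"
    using continuous_map_compose[OF c continuous_act] by (simp add: o_def)
  then have k: "continuous_map (fibre_space K q (gsrc G g)) K (restrict (act g) ?Ku)"
    by (rule continuous_map_eq) (simp add: fibre_space_def)
  have "restrict (act g) ?Ku \<in> topspace (fibre_space K q (gsrc G g)) \<rightarrow> fibre K q (grng G g)"
  proof
    fix x assume "x \<in> topspace (fibre_space K q (gsrc G g))"
    then have x: "x \<in> ?Ku" "x \<in> topspace (fibre_space K q (gsrc G g))"
      by (auto simp: fibre_space_def)
    then have "act g x \<in> topspace K"
      using continuous_map_funspace[OF k] by (auto simp: Pi_iff)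
    then show "restrict (act g) ?Ku x \<in> fibre K q (grng G g)"
      using x q_act[OF g, of x] by (auto simp: fibre_def)
  qed
  with k have "continuous_map (fibre_space K q (gsrc G g)) (fibre_space K q (grng G g))
      (restrict (act g) ?Ku)"
    unfolding fibre_space_def[of K q "grng G g"] continuous_map_in_subtopology by auto
  moreover have "gsrc G g \<in> gunits G"
    using g by (simp add: gunits_def)
  ultimately show ?thesis
    using grng_in_gunits[OF g] unfolding fibre_maps_def act_map_def by auto
qed

lemma fibre_comp_in_fibre_maps:
  assumes "\<theta> \<in> fibre_maps K q G" "\<eta> \<in> fibre_maps K q G" "frng \<eta> = fsrc \<theta>"
  shows "fibre_comp K q \<theta> \<eta> \<in> fibre_maps K q G"
proof -
  obtain v w f where f: "\<theta> = Fibre_Map v w f" "w \<in> gunits G"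
      "continuous_map (fibre_space K q v) (fibre_space K q w) f"
    using assms(1) unfolding fibre_maps_def by blast
  obtain u h where h: "\<eta> = Fibre_Map u v h" "u \<in> gunits G"
      "continuous_map (fibre_space K q u) (fibre_space K q v) h"
    using assms(2,3) f(1) unfolding fibre_maps_def by auto
  have "continuous_map (fibre_space K q u) (fibre_space K q w) (compose (fibre K q u) f h)"
    by (rule continuous_map_eq[OF continuous_map_compose[OF h(3) f(3)]])
      (simp add: fibre_space_def compose_def)
  then show ?thesis
    using f h unfolding fibre_maps_def fibre_comp_def by auto
qed

lemma (in groupoid_action) enveloping_candidate_fibre_maps:
  "enveloping_candidate K q G act (fibre_maps K q G)"
  unfolding enveloping_candidate_def
  using act_map_in_fibre_maps fibre_comp_in_fibre_maps
    closedin_topspace[of "compact_open_topology K q G"] by auto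

lemma (in groupoid_action) uniform_enveloping_semigroupoid_least:
  "enveloping_candidate K q G act (uniform_enveloping_semigroupoid K q G act)"
  "enveloping_candidate K q G act S \<Longrightarrow> uniform_enveloping_semigroupoid K q G act \<subseteq> S"
proof -
  let ?E = "uniform_enveloping_semigroupoid K q G act"
  have mem: "\<theta> \<in> ?E \<longleftrightarrow> (\<forall>S. enveloping_candidate K q G act S \<longrightarrow> \<theta> \<in> S)" for \<theta>
    unfolding uniform_enveloping_semigroupoid_def by blast
  have "closedin (compact_open_topology K q G) ?E"
    unfolding uniform_enveloping_semigroupoid_def
  proof (rule closedin_Inter)
    show "{S. enveloping_candidate K q G act S} \<noteq> {}"
      using enveloping_candidate_fibre_maps by blast
  qed (simp add: enveloping_candidate_def)
  moreover have "\<forall>\<theta>\<in>?E. \<forall>\<eta>\<in>?E. frng \<eta> = fsrc \<theta> \<longrightarrow> fibre_comp K q \<theta> \<eta> \<in> ?E"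
    unfolding mem Ball_def by (simp add: enveloping_candidate_def)
  moreover have "\<forall>g\<in>garrows G. act_map K q G act g \<in> ?E"
    unfolding mem Ball_def by (simp add: enveloping_candidate_def)
  ultimately show "enveloping_candidate K q G act ?E"
    unfolding enveloping_candidate_def by blast
qed (auto simp: uniform_enveloping_semigroupoid_def)

end

theory Submission imports Defs begin

text \<open>
  Write \<open>\<C>\<close> for the space of continuous maps between fibres with the compact-open topology, and
  \<open>\<E>\<close> for the enveloping semigroupoid. Openness of \<open>q\<close> is what makes \<open>\<C>\<close> well behaved: it is
  Hausdorff because maps on nearby fibres can be compared near a given point.

  Suppose that an invariant family of pseudometrics \<open>P\<close> is given. The fibre maps that preserve
  \<open>P\<close> and are onto form an Arzela-Ascoli type compact set (\<open>compact_isometries\<close>): along an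
  ultrafilter of such maps the graphs, as subsets of \<open>K \<times> K\<close>, have a limit set; invariance passes
  to the limit and forces the limit set to be the graph of an injective map, openness of \<open>q\<close> makes
  it total and onto, and its closedness makes the map continuous. Thus the isometries are a closed
  subset of \<open>\<C>\<close> that competes in the definition of \<open>\<E>\<close>, so that \<open>\<E>\<close> is a compact set of
  bijections. Inversion turns the subbasic set of the pair \<open>(C, V)\<close> into that of the
  complementary pair \<open>(K - V, K - C)\<close> and is therefore continuous. Hence the isometries whose
  inverse lies in \<open>\<E>\<close> also compete, and \<open>\<E>\<close> is closed under inversion.

  Suppose conversely that \<open>\<E>\<close> is a compact groupoid. The pairs (source, range) of elements of
  \<open>\<E>\<close> form a closed equivalence relation on the unit space, whose quotient is a compact Hausdorff
  space on which source and range of an arrow agree. Ergodicity makes this quotient a point, so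
  \<open>\<E>\<close> is transitive (\<open>E_transitive\<close>). Fix a base unit and let \<open>f\<close> be a continuous real
  function on \<open>K\<close>. Then
  \<open>p (x, y) = sup {\<bar>f (\<theta> x) - f (\<theta> y)\<bar> : \<theta> \<in> \<E> from the fibre of x to the base fibre}\<close> is an
  invariant pseudometric on every fibre. The set \<open>{p \<le> c}\<close> and, up to an
  intersection, also \<open>{p \<ge> c}\<close> consists of the pairs \<open>(x, y)\<close> that some such \<open>\<theta>\<close> moves into a
  given closed set; for \<open>{p \<le> c}\<close> this holds because any two such \<open>\<theta>\<close> differ by an element of
  the isotropy group of the base unit. Such sets are closed, since the projection along the compact
  space \<open>\<E>\<close> is a closed map. So \<open>p\<close> is
  continuous, and the Urysohn lemma supplies enough functions \<open>f\<close> to separate the points of each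
  fibre, which for a compact fibre is enough to generate its topology.
\<close>

section \<open>Ultrafilters and compactness\<close>

definition ultrafilter :: "'a filter \<Rightarrow> bool" where
  "ultrafilter F \<longleftrightarrow> F \<noteq> bot \<and> (\<forall>P. eventually P F \<or> eventually (\<lambda>x. \<not> P x) F)"

lemma ultrafilterD: "ultrafilter F \<Longrightarrow> \<not> eventually P F \<Longrightarrow> eventually (\<lambda>x. \<not> P x) F"
  unfolding ultrafilter_def by blast

lemma ultrafilter_ex: "ultrafilter F \<Longrightarrow> eventually P F \<Longrightarrow> \<exists>x. P x"
  unfolding ultrafilter_def using eventually_happens by blast

text \<open>Zorn's lemma for proper filters under reverse inclusion: a chain of them has its infimum as a
  proper lower bound, and a minimal proper filter decides every predicate, because otherwise it
  could be restricted to that predicate.\<close>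

lemma ex_ultrafilter_le:
  assumes F: "F \<noteq> bot"
  obtains U where "ultrafilter U" "U \<le> F"
proof -
  let ?A = "{G. G \<noteq> bot \<and> G \<le> F}"
  have "\<exists>m\<in>?A. \<forall>a\<in>?A. m \<ge> a \<longrightarrow> a = m"
  proof (rule predicate_Zorn)
    show "partial_order_on ?A (relation_of (\<ge>) ?A)"
      unfolding partial_order_on_def preorder_on_def refl_on_def trans_def antisym_def relation_of_def
      by auto
    fix C assume C: "C \<in> Chains (relation_of (\<ge>) ?A)"
    show "\<exists>u\<in>?A. \<forall>a\<in>C. a \<ge> u"
    proof (cases "C = {}")
      case False
      have CA: "C \<subseteq> ?A" and tot: "G \<le> H \<or> H \<le> G" if "G \<in> C" "H \<in> C" for G H
        using C that unfolding Chains_def relation_of_def by auto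
      have "eventually (\<lambda>_. False) (Inf C) \<longleftrightarrow> (\<exists>b\<in>C. eventually (\<lambda>_. False) b)"
      proof (rule eventually_Inf_base[OF False])
        fix G H assume "G \<in> C" "H \<in> C"
        then show "\<exists>x\<in>C. x \<le> inf G H"
          using tot[of G H] by (metis inf.absorb1 inf.absorb2 order_refl)
      qed
      then have "Inf C \<noteq> bot"
        using CA False by (auto simp: trivial_limit_def)
      moreover have "Inf C \<le> F"
        using CA False by (auto intro: Inf_lower2)
      ultimately show ?thesis by (auto intro: Inf_lower)
    qed (use F in auto)
  qed
  then obtain m where m: "m \<noteq> bot" "m \<le> F"
    and max: "\<And>a. a \<noteq> bot \<Longrightarrow> a \<le> F \<Longrightarrow> a \<le> m \<Longrightarrow> a = m"
    by auto
  have "eventually P m \<or> eventually (\<lambda>x. \<not> P x) m" for P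
  proof (cases "inf m (principal (Collect P)) = bot")
    case True
    then have "eventually (\<lambda>_. False) (inf m (principal (Collect P)))"
      by simp
    then show ?thesis by (simp add: eventually_inf_principal)
  next
    case False
    then have "inf m (principal (Collect P)) = m"
      using m by (intro max) (auto intro: le_infI1)
    then have "m \<le> principal (Collect P)"
      by (metis inf_le2)
    then show ?thesis by (simp add: le_principal)
  qed
  with m show ?thesis
    using that unfolding ultrafilter_def by blast
qed

text \<open>If no point were a limit, each point would have a neighbourhood that the ultrafilter avoids;
  finitely many of these cover the space.\<close>

lemma ultrafilter_limitin_compact:
  assumes F: "ultrafilter F" and X: "compact_space X"
    and ev: "eventually (\<lambda>x. f x \<in> topspace X) F"
  obtains l where "limitin X f l F"
proof -
  have "\<exists>l. limitin X f l F"
  proof (rule ccontr)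
    assume "\<nexists>l. limitin X f l F"
    then have "\<forall>l\<in>topspace X. \<exists>U. openin X U \<and> l \<in> U \<and> \<not> eventually (\<lambda>x. f x \<in> U) F"
      unfolding limitin_def by blast
    then obtain U where U: "\<And>l. l \<in> topspace X \<Longrightarrow>
        openin X (U l) \<and> l \<in> U l \<and> \<not> eventually (\<lambda>x. f x \<in> U l) F"
      by metis
    have "\<exists>\<F>. finite \<F> \<and> \<F> \<subseteq> U ` topspace X \<and> topspace X \<subseteq> \<Union>\<F>"
      using X[unfolded compact_space_alt, rule_format, of "U ` topspace X"] U by auto
    then obtain L where L: "finite L" "L \<subseteq> topspace X" "topspace X \<subseteq> (\<Union>l\<in>L. U l)"
      by (metis finite_subset_image)
    have "eventually (\<lambda>x. \<forall>l\<in>L. f x \<notin> U l) F"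
      using L U ultrafilterD[OF F] by (intro eventually_ball_finite) blast+
    with ev have "eventually (\<lambda>x. False) F"
      by eventually_elim (use L in auto)
    then show False
      using ultrafilter_ex[OF F] by blast
  qed
  then show ?thesis using that by blast
qed

text \<open>An ultrafilter refining a family of closed sets with the finite intersection property has all
  its limits in the intersection of the family.\<close>

lemma compact_space_if_ultrafilter_limits:
  assumes lim: "\<And>F. ultrafilter F \<Longrightarrow> eventually (\<lambda>x. x \<in> topspace X) F \<Longrightarrow> \<exists>l. limitin X (\<lambda>x. x) l F"
  shows "compact_space X"
  unfolding compact_space_fip
proof (intro allI impI)
  fix \<U> assume "(\<forall>C\<in>\<U>. closedin X C) \<and> (\<forall>\<F>. finite \<F> \<and> \<F> \<subseteq> \<U> \<longrightarrow> \<Inter>\<F> \<noteq> {})"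
  then have cl: "\<And>C. C \<in> \<U> \<Longrightarrow> closedin X C"
    and fip: "\<And>\<F>. finite \<F> \<Longrightarrow> \<F> \<subseteq> \<U> \<Longrightarrow> \<Inter>\<F> \<noteq> {}" by auto
  show "\<Inter>\<U> \<noteq> {}"
  proof (cases "\<U> = {}")
    case False
    let ?F0 = "INF C\<in>\<U>. principal C"
    have "?F0 \<noteq> bot"
    proof (rule INF_filter_not_bot)
      fix B assume "B \<subseteq> \<U>" "finite B"
      then show "(INF C\<in>B. principal C) \<noteq> bot"
        using fip by (simp add: INF_principal_finite principal_eq_bot_iff)
    qed
    then obtain F where F: "ultrafilter F" "F \<le> ?F0"
      by (rule ex_ultrafilter_le)
    have evC: "eventually (\<lambda>x. x \<in> C) F" if "C \<in> \<U>" for C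
    proof -
      have "F \<le> principal C"
        using F(2) that by (meson INF_lower order_trans)
      then show ?thesis by (simp add: le_principal)
    qed
    obtain C0 where C0: "C0 \<in> \<U>" using False by blast
    have "eventually (\<lambda>x. x \<in> topspace X) F"
      using evC[OF C0] by eventually_elim (use cl[OF C0] closedin_subset in blast)
    then obtain l where l: "limitin X (\<lambda>x. x) l F"
      using lim F by blast
    have "l \<in> C" if "C \<in> \<U>" for C
    proof (rule ccontr)
      assume "l \<notin> C"
      then have "eventually (\<lambda>x. x \<in> topspace X - C) F"
        using limitinD[OF l, of "topspace X - C"] cl[OF that] limitin_topspace[OF l]
        by (auto simp: closedin_def)
      with evC[OF that] have "eventually (\<lambda>x. False) F"
        by eventually_elim auto
      then show False
        using ultrafilter_ex[OF F(1)] by blast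
    qed
    then show ?thesis by blast
  qed auto
qed

lemma limitin_topology_generated_by:
  assumes l: "l \<in> \<Union>\<S>"
    and ev: "\<And>V. V \<in> \<S> \<Longrightarrow> l \<in> V \<Longrightarrow> eventually (\<lambda>x. f x \<in> V) F"
  shows "limitin (topology_generated_by \<S>) f l F"
  unfolding limitin_def
proof (intro conjI allI impI)
  fix V assume "openin (topology_generated_by \<S>) V \<and> l \<in> V"
  then have "generate_topology_on \<S> V" and "l \<in> V"
    by (auto simp: openin_topology_generated_by_iff)
  then show "eventually (\<lambda>x. f x \<in> V) F"
  proof induction
    case (Int a b)
    then show ?case by (auto intro: eventually_conj)
  next
    case (UN \<K>)
    then obtain k where k: "k \<in> \<K>" "l \<in> k" by blast
    then have "eventually (\<lambda>x. f x \<in> k) F" using UN by blast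
    then show ?case by eventually_elim (use k in blast)
  qed (use ev in auto)
qed (use l in simp)

section \<open>Limits of closed sets along an ultrafilter\<close>

text \<open>For closed subsets \<open>A i\<close> of a compact Hausdorff space and an ultrafilter this is the limit in
  the Fell topology. It replaces the pointwise limit of functions when the domains of the functions vary with \<open>i\<close>.\<close>

definition set_limit :: "'a topology \<Rightarrow> 'b filter \<Rightarrow> ('b \<Rightarrow> 'a set) \<Rightarrow> 'a set" where
  "set_limit X F A =
     {z \<in> topspace X. \<forall>V. openin X V \<and> z \<in> V \<longrightarrow> eventually (\<lambda>i. A i \<inter> V \<noteq> {}) F}"

lemma set_limitD:
  "z \<in> set_limit X F A \<Longrightarrow> openin X V \<Longrightarrow> z \<in> V \<Longrightarrow> eventually (\<lambda>i. A i \<inter> V \<noteq> {}) F"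
  unfolding set_limit_def by blast

lemma closedin_set_limit: "closedin X (set_limit X F A)"
proof -
  have "topspace X - set_limit X F A =
      \<Union>{V. openin X V \<and> \<not> eventually (\<lambda>i. A i \<inter> V \<noteq> {}) F}"
    unfolding set_limit_def by (auto dest: openin_subset)
  then have "openin X (topspace X - set_limit X F A)"
    by (simp only:) (rule openin_Union, blast)
  then show ?thesis
    unfolding closedin_def set_limit_def by auto
qed

text \<open>The converse half of Fell convergence: each point of \<open>D\<close> has a neighbourhood that the sets
  eventually avoid, and finitely many of these cover \<open>D\<close>.\<close>

lemma set_limit_eventually_disjoint:
  assumes F: "ultrafilter F" and X: "compact_space X"
    and D: "closedin X D" and disj: "D \<inter> set_limit X F A = {}"
  shows "eventually (\<lambda>i. A i \<inter> D = {}) F"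
proof -
  have "\<forall>z\<in>D. \<exists>V. openin X V \<and> z \<in> V \<and> \<not> eventually (\<lambda>i. A i \<inter> V \<noteq> {}) F"
    using disj closedin_subset[OF D] unfolding set_limit_def by blast
  then obtain V where V: "\<And>z. z \<in> D \<Longrightarrow>
      openin X (V z) \<and> z \<in> V z \<and> \<not> eventually (\<lambda>i. A i \<inter> V z \<noteq> {}) F"
    by metis
  have "compactin X D"
    using X D closedin_compact_space by blast
  then have "\<exists>\<F>. finite \<F> \<and> \<F> \<subseteq> V ` D \<and> D \<subseteq> \<Union>\<F>"
    unfolding compactin_def using V by (auto elim!: allE[of _ "V ` D"])
  then obtain Z where Z: "finite Z" "Z \<subseteq> D" "D \<subseteq> (\<Union>z\<in>Z. V z)"
    by (metis finite_subset_image)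
  have "eventually (\<lambda>i. \<forall>z\<in>Z. A i \<inter> V z = {}) F"
    using Z V ultrafilterD[OF F] by (intro eventually_ball_finite) fastforce+
  then show ?thesis
    by eventually_elim (use Z in blast)
qed

section \<open>Quotients of compact Hausdorff spaces by closed equivalence relations\<close>

text \<open>The saturation of a closed set \<open>C\<close> is the projection of \<open>r \<inter> C \<times> Y\<close>, hence closed because
  \<open>Y\<close> is compact. So the quotient map is closed, and closed continuous images of normal Hausdorff
  spaces are Hausdorff.\<close>

lemma compact_Hausdorff_quotient:
  assumes Y: "compact_space Y" "Hausdorff_space Y"
    and eq: "equiv (topspace Y) r" and cl: "closedin (prod_topology Y Y) r"
  obtains M :: "'a set topology" where "compact_space M" "Hausdorff_space M"
    "continuous_map Y M (\<lambda>x. r `` {x})" "(\<lambda>x. r `` {x}) ` topspace Y = topspace M"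
proof -
  let ?\<pi> = "\<lambda>x. r `` {x}"
  let ?op = "\<lambda>V. V \<subseteq> ?\<pi> ` topspace Y \<and> openin Y {x \<in> topspace Y. ?\<pi> x \<in> V}"
  have "istopology ?op"
    unfolding istopology_def
  proof (intro conjI allI impI)
    fix S T assume "?op S" "?op T"
    moreover have "{x \<in> topspace Y. ?\<pi> x \<in> S \<inter> T} =
        {x \<in> topspace Y. ?\<pi> x \<in> S} \<inter> {x \<in> topspace Y. ?\<pi> x \<in> T}" by blast
    ultimately show "S \<inter> T \<subseteq> ?\<pi> ` topspace Y" "openin Y {x \<in> topspace Y. ?\<pi> x \<in> S \<inter> T}"
      by (auto simp only: openin_Int)
  next
    fix \<K> assume "\<forall>S\<in>\<K>. ?op S"
    moreover have "{x \<in> topspace Y. ?\<pi> x \<in> \<Union>\<K>} = (\<Union>S\<in>\<K>. {x \<in> topspace Y. ?\<pi> x \<in> S})" by blast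
    ultimately show "\<Union>\<K> \<subseteq> ?\<pi> ` topspace Y" "openin Y {x \<in> topspace Y. ?\<pi> x \<in> \<Union>\<K>}"
      by (auto simp only: openin_Union)
  qed
  define M where "M = topology ?op"
  have oM: "openin M V \<longleftrightarrow> ?op V" for V
    unfolding M_def using topology_inverse'[OF \<open>istopology ?op\<close>] by simp
  have "openin M (?\<pi> ` topspace Y)"
    unfolding oM by (simp add: Collect_conj_eq2 image_iff) (metis (mono_tags, lifting) Collect_cong Collect_mem_eq openin_topspace)
  then have tM: "topspace M = ?\<pi> ` topspace Y"
    using openin_subset oM by (metis openin_topspace subset_antisym)
  have cont: "continuous_map Y M ?\<pi>"
    unfolding continuous_map_def tM using oM by simp
  have "closed_map Y M ?\<pi>"
    unfolding closed_map_def
  proof (intro allI impI)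
    fix C assume C: "closedin Y C"
    have sat: "{x \<in> topspace Y. ?\<pi> x \<in> ?\<pi> ` C} = snd ` (r \<inter> C \<times> topspace Y)"
    proof -
      have "?\<pi> x \<in> ?\<pi> ` C \<longleftrightarrow> (\<exists>c\<in>C. (c, x) \<in> r)" if "x \<in> topspace Y" for x
      proof -
        have "?\<pi> x = ?\<pi> c \<longleftrightarrow> (c, x) \<in> r" if "c \<in> C" for c
          using eq_equiv_class_iff[OF eq, of c x] closedin_subset[OF C] that \<open>x \<in> topspace Y\<close> by blast
        then show ?thesis by blast
      qed
      then have "{x \<in> topspace Y. ?\<pi> x \<in> ?\<pi> ` C} = {x \<in> topspace Y. \<exists>c\<in>C. (c, x) \<in> r}" by blast
      also have "\<dots> = snd ` (r \<inter> C \<times> topspace Y)"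
        unfolding snd_eq_Range by auto
      finally show ?thesis .
    qed
    have "closedin (prod_topology Y Y) (r \<inter> C \<times> topspace Y)"
      using C by (intro closedin_Int cl) (simp add: closedin_prod_Times_iff)
    then have "closedin Y {x \<in> topspace Y. ?\<pi> x \<in> ?\<pi> ` C}"
      unfolding sat using closed_map_snd[OF Y(1), of Y] unfolding closed_map_def by blast
    moreover have "{x \<in> topspace Y. ?\<pi> x \<in> ?\<pi> ` topspace Y - ?\<pi> ` C} =
        topspace Y - {x \<in> topspace Y. ?\<pi> x \<in> ?\<pi> ` C}" by blast
    ultimately have "openin M (topspace M - ?\<pi> ` C)"
      unfolding oM tM by (auto simp only: closedin_def)
    then show "closedin M (?\<pi> ` C)"
      unfolding closedin_def tM using closedin_subset[OF C] by blast
  qed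
  then have "Hausdorff_space M"
    using normal_Hausdorff_space_closed_continuous_map_image[OF _ Y(2) _ cont tM[symmetric]]
      compact_Hausdorff_or_regular_imp_normal_space Y by blast
  moreover have "compact_space M"
    using image_compactin[OF _ cont, of "topspace Y"] Y(1) tM by (simp add: compact_space_def)
  ultimately show ?thesis using that cont tM by blast
qed

section \<open>Topologies generated by pseudometrics on compact spaces\<close>

text \<open>The identity is a continuous map from a compact space to one that is Hausdorff, because the
  pseudometrics separate points; hence it is a homeomorphism.\<close>

lemma pseudometric_topology_eq_compact:
  assumes Y: "compact_space Y"
    and cont: "\<And>p. p \<in> P \<Longrightarrow> continuous_map (prod_topology Y Y) euclideanreal p"
    and pm: "\<And>p. p \<in> P \<Longrightarrow> pseudometric_on (topspace Y) p"
    and sep: "\<And>x y. x \<in> topspace Y \<Longrightarrow> y \<in> topspace Y \<Longrightarrow> x \<noteq> y \<Longrightarrow> \<exists>p\<in>P. p (x, y) > 0"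
  shows "pseudometric_topology (topspace Y) P = Y"
proof -
  let ?D = "pseudometric_topology (topspace Y) P"
  define ball where "ball p x \<epsilon> = {y \<in> topspace Y. p (x, y) < \<epsilon>}" for p :: "'a \<times> 'a \<Rightarrow> real" and x \<epsilon>
  have D: "?D = topology_generated_by
      (insert (topspace Y) {ball p x \<epsilon> | p x \<epsilon>. p \<in> P \<and> x \<in> topspace Y \<and> 0 < \<epsilon>})"
    by (simp add: pseudometric_topology_def ball_def)
  have oD: "openin ?D (ball p x \<epsilon>)" if "p \<in> P" "x \<in> topspace Y" "0 < \<epsilon>" for p x \<epsilon>
    unfolding D by (rule topology_generated_by_Basis) (use that in blast)
  have oY: "openin Y (ball p x \<epsilon>)" if p: "p \<in> P" and x: "x \<in> topspace Y" for p x \<epsilon>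
  proof -
    have "continuous_map Y (prod_topology Y Y) (\<lambda>y. (x, y))"
      using x by (intro continuous_map_pairedI) auto
    from continuous_map_compose[OF this cont[OF p]]
    have "continuous_map Y euclideanreal (\<lambda>y. p (x, y))" by (simp add: o_def)
    from openin_continuous_map_preimage[OF this, of "{..<\<epsilon>}"]
    show ?thesis by (simp add: ball_def)
  qed
  have "continuous_map Y ?D id"
    unfolding D
  proof (rule continuous_on_generated_topo)
    fix U assume "U \<in> insert (topspace Y) {ball p x \<epsilon> | p x \<epsilon>. p \<in> P \<and> x \<in> topspace Y \<and> 0 < \<epsilon>}"
    then have "openin Y U" using oY by auto
    then show "openin Y (id -` U \<inter> topspace Y)" by (auto simp: openin_subset Int_absorb2)
  qed auto
  moreover have "Hausdorff_space ?D"
    unfolding Hausdorff_space_def topspace_pseudometric_topology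
  proof (intro allI impI)
    fix x y assume xy: "x \<in> topspace Y \<and> y \<in> topspace Y \<and> x \<noteq> y"
    then obtain p where p: "p \<in> P" "p (x, y) > 0" using sep by blast
    let ?e = "p (x, y) / 2"
    note d = pm[OF p(1), unfolded pseudometric_on_def]
    have "x \<in> ball p x ?e" "y \<in> ball p y ?e"
      using d xy p(2) by (auto simp: ball_def)
    moreover have "disjnt (ball p x ?e) (ball p y ?e)"
      unfolding disjnt_iff
    proof (intro allI notI)
      fix z assume z: "z \<in> ball p x ?e \<and> z \<in> ball p y ?e"
      then have "z \<in> topspace Y" by (simp add: ball_def)
      with d xy have "p (x, y) \<le> p (x, z) + p (z, y)" "p (z, y) = p (y, z)"
        by blast+
      with z show False by (auto simp: ball_def)
    qed
    ultimately show "\<exists>U V. openin ?D U \<and> openin ?D V \<and> x \<in> U \<and> y \<in> V \<and> disjnt U V"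
      using oD[OF p(1), of x ?e] oD[OF p(1), of y ?e] xy p(2)
      by (intro exI[of _ "ball p x ?e"] exI[of _ "ball p y ?e"]) simp
  qed
  ultimately have "homeomorphic_map Y ?D id"
    using Y by (intro continuous_imp_homeomorphic_map) auto
  then show ?thesis by simp
qed

section \<open>Fibre maps and the compact-open topology\<close>

lemma (in groupoid_action) q_in_gunits: "x \<in> topspace K \<Longrightarrow> q x \<in> gunits G"
  using continuous_map_funspace[OF continuous_q] by (auto simp: unit_space_def)

lemma (in groupoid) gunits_subset: "gunits G \<subseteq> garrows G"
proof -
  have "gsrc G g \<in> garrows G" if "g \<in> garrows G" for g
    unfolding gsrc_def
    by (rule mult_closed) (use that inv_closed inv_inv in \<open>auto simp: gsrc_def grng_def\<close>)
  then show ?thesis unfolding gunits_def by blast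
qed

lemma (in groupoid) src_rng_unit:
  assumes "u \<in> gunits G" shows "gsrc G u = u" "grng G u = u"
proof -
  obtain g where g: "g \<in> garrows G" "u = gsrc G g" using assms by (auto simp: gunits_def)
  have sr: "gsrc G (ginv G g) = grng G g" "grng G (ginv G g) = gsrc G g"
    using inv_inv[OF g(1)] by (simp_all add: gsrc_def grng_def)
  show "gsrc G u = u" "grng G u = u"
    using src_mult[OF inv_closed[OF g(1)] g(1) sr(1)] rng_mult[OF inv_closed[OF g(1)] g(1) sr(1)] sr(2)
    by (simp_all add: g(2) gsrc_def[of G g])
qed

lemma (in groupoid) topspace_unit_space [simp]: "topspace (unit_space G) = gunits G"
  using gunits_subset by (auto simp: unit_space_def garrows_def)

lemma fibre_subset: "fibre K q u \<subseteq> topspace K"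
  by (auto simp: fibre_def)

lemma topspace_fibre_space [simp]: "topspace (fibre_space K q u) = fibre K q u"
  by (auto simp: fibre_space_def fibre_def)

lemma fibre_mapsD:
  assumes "\<theta> \<in> fibre_maps K q G"
  shows "fsrc \<theta> \<in> gunits G" "frng \<theta> \<in> gunits G"
    "ffun \<theta> \<in> extensional (fibre K q (fsrc \<theta>))"
    "continuous_map (fibre_space K q (fsrc \<theta>)) (fibre_space K q (frng \<theta>)) (ffun \<theta>)"
    "x \<in> fibre K q (fsrc \<theta>) \<Longrightarrow> ffun \<theta> x \<in> fibre K q (frng \<theta>)"
proof -
  obtain u v f where uv: "\<theta> = Fibre_Map u v f" "u \<in> gunits G" "v \<in> gunits G"
      "f \<in> extensional (fibre K q u)" "continuous_map (fibre_space K q u) (fibre_space K q v) f"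
    using assms unfolding fibre_maps_def by blast
  then show "fsrc \<theta> \<in> gunits G" "frng \<theta> \<in> gunits G"
    "ffun \<theta> \<in> extensional (fibre K q (fsrc \<theta>))"
    "continuous_map (fibre_space K q (fsrc \<theta>)) (fibre_space K q (frng \<theta>)) (ffun \<theta>)"
    by auto
  show "x \<in> fibre K q (fsrc \<theta>) \<Longrightarrow> ffun \<theta> x \<in> fibre K q (frng \<theta>)"
    using continuous_map_funspace[OF uv(5)] uv(1) by auto
qed

lemma fibre_mapsI:
  assumes "fsrc \<theta> \<in> gunits G" "frng \<theta> \<in> gunits G"
    "ffun \<theta> \<in> extensional (fibre K q (fsrc \<theta>))"
    "continuous_map (fibre_space K q (fsrc \<theta>)) (fibre_space K q (frng \<theta>)) (ffun \<theta>)"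
  shows "\<theta> \<in> fibre_maps K q G"
  using assms by (cases \<theta>) (auto simp: fibre_maps_def)

lemma openin_compact_open_subbase:
  assumes "compactin K C" "openin K V"
  shows "openin (compact_open_topology K q G)
    {\<theta> \<in> fibre_maps K q G. ffun \<theta> ` (C \<inter> fibre K q (fsrc \<theta>)) \<subseteq> V}"
  unfolding compact_open_topology_def by (rule topology_generated_by_Basis) (use assms in blast)

context groupoid_action
begin

abbreviation \<C> where "\<C> \<equiv> compact_open_topology K q G"

lemma fibre_nonempty:
  assumes "u \<in> gunits G" shows "fibre K q u \<noteq> {}"
proof -
  have "u \<in> q ` topspace K" using assms surj_q by simp
  then show ?thesis by (auto simp: fibre_def)
qed

lemma Hausdorff_unit_space: "Hausdorff_space (unit_space G)"
  unfolding unit_space_def using Hausdorff by (rule Hausdorff_space_subtopology)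

lemma compact_unit_space: "compact_space (unit_space G)"
  using image_compactin[OF _ continuous_q, of "topspace K"] compact_K surj_q
  by (simp add: compact_space_def)

lemma closedin_fibre:
  assumes "u \<in> gunits G" shows "closedin K (fibre K q u)"
proof -
  have "closedin (unit_space G) {u}"
    using assms Hausdorff_unit_space by (simp add: closedin_Hausdorff_sing_eq)
  from closedin_continuous_map_preimage[OF continuous_q this]
  show ?thesis by (simp add: fibre_def)
qed

lemma compact_fibre_space: "u \<in> gunits G \<Longrightarrow> compact_space (fibre_space K q u)"
  unfolding fibre_space_def using closedin_fibre compact_K
  by (meson closedin_compact_space compact_space_subtopology)

lemma Hausdorff_fibre_space: "Hausdorff_space (fibre_space K q u)"
  unfolding fibre_space_def using Hausdorff_K by (rule Hausdorff_space_subtopology)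

text \<open>The source lies in an open set \<open>V\<close> of units exactly if the source fibre misses the compact
  preimage under \<open>q\<close> of the complement of \<open>V\<close>; this is the subbasic condition with empty target, because
  fibres are nonempty.\<close>

lemma continuous_fsrc: "continuous_map \<C> (unit_space G) fsrc"
  unfolding continuous_map_def
proof (intro conjI allI impI)
  show "fsrc \<in> topspace \<C> \<rightarrow> topspace (unit_space G)"
    using fibre_mapsD(1) by auto
  fix V assume V: "openin (unit_space G) V"
  let ?C = "{x \<in> topspace K. q x \<in> topspace (unit_space G) - V}"
  have "closedin K ?C"
    using V by (intro closedin_continuous_map_preimage[OF continuous_q] closedin_diff closedin_topspace)
  then have "compactin K ?C"
    using compact_K closedin_compact_space by blast
  then have op: "openin \<C> {\<theta> \<in> fibre_maps K q G. ffun \<theta> ` (?C \<inter> fibre K q (fsrc \<theta>)) \<subseteq> {}}"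
    by (rule openin_compact_open_subbase) simp
  have "?C \<inter> fibre K q u = {} \<longleftrightarrow> u \<in> V" if "u \<in> gunits G" for u
    using fibre_nonempty[OF that] that by (auto simp: fibre_def)
  note source_iff = this
  have "{\<theta> \<in> fibre_maps K q G. ffun \<theta> ` (?C \<inter> fibre K q (fsrc \<theta>)) \<subseteq> {}} =
      {\<theta> \<in> topspace \<C>. fsrc \<theta> \<in> V}"
    unfolding subset_empty image_is_empty topspace_compact_open_topology
    by (intro Collect_cong conj_cong refl) (rule source_iff[OF fibre_mapsD(1)])
  with op show "openin \<C> {\<theta> \<in> topspace \<C>. fsrc \<theta> \<in> V}" by simp
qed

lemma continuous_frng: "continuous_map \<C> (unit_space G) frng"
  unfolding continuous_map_def
proof (intro conjI allI impI)
  show "frng \<in> topspace \<C> \<rightarrow> topspace (unit_space G)"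
    using fibre_mapsD(2) by auto
  fix V assume V: "openin (unit_space G) V"
  let ?W = "{x \<in> topspace K. q x \<in> V}"
  have op: "openin \<C> {\<theta> \<in> fibre_maps K q G. ffun \<theta> ` (topspace K \<inter> fibre K q (fsrc \<theta>)) \<subseteq> ?W}"
    using openin_continuous_map_preimage[OF continuous_q V] compact_K
    by (intro openin_compact_open_subbase) (auto simp: compact_space_def)
  have "ffun \<theta> ` (topspace K \<inter> fibre K q (fsrc \<theta>)) \<subseteq> ?W \<longleftrightarrow> frng \<theta> \<in> V"
    if t: "\<theta> \<in> fibre_maps K q G" for \<theta>
  proof -
    have "ffun \<theta> x \<in> ?W \<longleftrightarrow> frng \<theta> \<in> V" if "x \<in> fibre K q (fsrc \<theta>)" for x
      using fibre_mapsD(5)[OF t that] by (auto simp: fibre_def)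
    moreover obtain x where "x \<in> fibre K q (fsrc \<theta>)"
      using fibre_nonempty[OF fibre_mapsD(1)[OF t]] by blast
    ultimately show ?thesis
      using fibre_subset[of K q "fsrc \<theta>"] by (simp only: image_subset_iff) blast
  qed
  then have "{\<theta> \<in> fibre_maps K q G. ffun \<theta> ` (topspace K \<inter> fibre K q (fsrc \<theta>)) \<subseteq> ?W} =
      {\<theta> \<in> topspace \<C>. frng \<theta> \<in> V}" by auto
  with op show "openin \<C> {\<theta> \<in> topspace \<C>. frng \<theta> \<in> V}" by simp
qed

lemma closed_neighbourhood:
  assumes "openin K N" "x \<in> N"
  obtains V C where "openin K V" "closedin K C" "x \<in> V" "V \<subseteq> C" "C \<subseteq> N"
proof -
  have "neighbourhood_base_of (closedin K) K"
    using compact_K Hausdorff_K compact_Hausdorff_imp_regular_space neighbourhood_base_of_closedin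
    by blast
  then show ?thesis
    using assms that unfolding neighbourhood_base_of by meson
qed

text \<open>The compact sets of the subbase can be chosen to be neighbourhoods in \<open>K\<close>, not only in one
  fibre. This lets a subbasic condition on \<open>\<theta>\<close> control the maps on neighbouring fibres.\<close>

lemma fibre_map_compact_neighbourhood:
  assumes t: "\<theta> \<in> fibre_maps K q G" and x: "x \<in> fibre K q (fsrc \<theta>)"
    and W: "openin K W" "ffun \<theta> x \<in> W"
  obtains V C where "openin K V" "compactin K C" "x \<in> V" "V \<subseteq> C"
    "ffun \<theta> ` (C \<inter> fibre K q (fsrc \<theta>)) \<subseteq> W"
proof -
  let ?F = "fibre K q (fsrc \<theta>)"
  have "openin (fibre_space K q (frng \<theta>)) (W \<inter> fibre K q (frng \<theta>))"
    unfolding fibre_space_def using W(1) by (rule openin_subtopology_Int)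
  from openin_continuous_map_preimage[OF fibre_mapsD(4)[OF t] this]
  have "openin (fibre_space K q (fsrc \<theta>)) {y \<in> ?F. ffun \<theta> y \<in> W \<inter> fibre K q (frng \<theta>)}"
    by simp
  then obtain N where N: "openin K N" "{y \<in> ?F. ffun \<theta> y \<in> W \<inter> fibre K q (frng \<theta>)} = N \<inter> ?F"
    unfolding fibre_space_def openin_subtopology by blast
  have "x \<in> N" using N(2) x W(2) fibre_mapsD(5)[OF t x] by blast
  obtain V C where VC: "openin K V" "closedin K C" "x \<in> V" "V \<subseteq> C" "C \<subseteq> N"
    using closed_neighbourhood[OF N(1) \<open>x \<in> N\<close>] .
  moreover have "compactin K C"
    using VC(2) compact_K closedin_compact_space by blast
  ultimately show ?thesis
    using that[of V C] N(2) by blast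
qed

text \<open>Maps with equal source and range that differ at \<open>x\<close> send a compact neighbourhood of \<open>x\<close>
  into disjoint open sets. The two subbasic conditions contradict each other only on fibres that
  meet the neighbourhood, so the source has to be confined to its image under \<open>q\<close>, which is open.\<close>

lemma Hausdorff_compact_open: "Hausdorff_space \<C>"
  unfolding Hausdorff_space_def
proof (intro allI impI)
  fix \<theta> \<eta> assume "\<theta> \<in> topspace \<C> \<and> \<eta> \<in> topspace \<C> \<and> \<theta> \<noteq> \<eta>"
  then have t: "\<theta> \<in> fibre_maps K q G" "\<eta> \<in> fibre_maps K q G" "\<theta> \<noteq> \<eta>" by auto
  have sep: "\<exists>U V. openin \<C> U \<and> openin \<C> V \<and> \<theta> \<in> U \<and> \<eta> \<in> V \<and> disjnt U V"
    if f: "continuous_map \<C> (unit_space G) f" and ne: "f \<theta> \<noteq> f \<eta>" for f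
  proof -
    have "f \<theta> \<in> topspace (unit_space G)" "f \<eta> \<in> topspace (unit_space G)"
      using continuous_map_funspace[OF f] t by (auto simp del: topspace_unit_space)
    then obtain U V where UV: "openin (unit_space G) U" "openin (unit_space G) V"
        "f \<theta> \<in> U" "f \<eta> \<in> V" "disjnt U V"
      using Hausdorff_unit_space ne unfolding Hausdorff_space_def by metis
    show ?thesis
      using openin_continuous_map_preimage[OF f UV(1)] openin_continuous_map_preimage[OF f UV(2)]
        UV(3-5) t
      by (intro exI[of _ "{\<zeta> \<in> topspace \<C>. f \<zeta> \<in> U}"] exI[of _ "{\<zeta> \<in> topspace \<C>. f \<zeta> \<in> V}"])
        (auto simp: disjnt_def)
  qed
  show "\<exists>U V. openin \<C> U \<and> openin \<C> V \<and> \<theta> \<in> U \<and> \<eta> \<in> V \<and> disjnt U V"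
  proof (cases "fsrc \<theta> = fsrc \<eta> \<and> frng \<theta> = frng \<eta>")
    case False
    then show ?thesis using sep continuous_fsrc continuous_frng by blast
  next
    case True
    then have "ffun \<theta> \<noteq> ffun \<eta>" using t(3) fibre_map.expand by blast
    then obtain x where x: "x \<in> fibre K q (fsrc \<theta>)" "ffun \<theta> x \<noteq> ffun \<eta> x"
      using fibre_mapsD(3)[OF t(1)] fibre_mapsD(3)[OF t(2)] True by (metis extensionalityI)
    have xe: "x \<in> fibre K q (fsrc \<eta>)" using x True by simp
    obtain W1 W2 where W: "openin K W1" "openin K W2" "ffun \<theta> x \<in> W1" "ffun \<eta> x \<in> W2" "disjnt W1 W2"
      using Hausdorff_K x(2) fibre_mapsD(5)[OF t(1) x(1)] fibre_mapsD(5)[OF t(2) xe]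
      unfolding Hausdorff_space_def fibre_def by blast
    obtain V1 C1 where 1: "openin K V1" "compactin K C1" "x \<in> V1" "V1 \<subseteq> C1"
        "ffun \<theta> ` (C1 \<inter> fibre K q (fsrc \<theta>)) \<subseteq> W1"
      using fibre_map_compact_neighbourhood[OF t(1) x(1) W(1,3)] .
    obtain V2 C2 where 2: "openin K V2" "compactin K C2" "x \<in> V2" "V2 \<subseteq> C2"
        "ffun \<eta> ` (C2 \<inter> fibre K q (fsrc \<eta>)) \<subseteq> W2"
      using fibre_map_compact_neighbourhood[OF t(2) xe W(2,4)] .
    let ?Q = "q ` (V1 \<inter> V2)"
    have oQ: "openin (unit_space G) ?Q"
      using open_q 1(1) 2(1) unfolding open_map_def by blast
    let ?S = "{\<zeta> \<in> topspace \<C>. fsrc \<zeta> \<in> ?Q}"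
    let ?A = "{\<zeta> \<in> fibre_maps K q G. ffun \<zeta> ` (C1 \<inter> fibre K q (fsrc \<zeta>)) \<subseteq> W1} \<inter> ?S"
    let ?B = "{\<zeta> \<in> fibre_maps K q G. ffun \<zeta> ` (C2 \<inter> fibre K q (fsrc \<zeta>)) \<subseteq> W2}"
    have "openin \<C> ?A"
      using openin_compact_open_subbase[OF 1(2) W(1)] openin_continuous_map_preimage[OF continuous_fsrc oQ]
      by (rule openin_Int)
    moreover have "openin \<C> ?B"
      using openin_compact_open_subbase[OF 2(2) W(2)] .
    moreover have "fsrc \<theta> \<in> ?Q"
      using x(1) 1(3) 2(3) by (intro image_eqI[of _ _ x]) (auto simp: fibre_def)
    then have "\<theta> \<in> ?A" using t(1) 1(5) by auto
    moreover have "\<eta> \<in> ?B" using t(2) 2(5) by auto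
    moreover have "disjnt ?A ?B"
      unfolding disjnt_iff
    proof (intro allI notI)
      fix \<zeta> assume z: "\<zeta> \<in> ?A \<and> \<zeta> \<in> ?B"
      then have "fsrc \<zeta> \<in> ?Q" by simp
      then obtain y where y: "y \<in> V1" "y \<in> V2" "q y = fsrc \<zeta>" by force
      then have "y \<in> fibre K q (fsrc \<zeta>)"
        using openin_subset[OF 1(1)] by (auto simp: fibre_def)
      then have "ffun \<zeta> y \<in> W1" "ffun \<zeta> y \<in> W2"
        using z y(1,2) 1(4) 2(4) by (simp_all add: image_subset_iff subset_iff)
      then show False using W(5) by (auto simp: disjnt_iff)
    qed
    ultimately show ?thesis by (intro exI[of _ ?A] exI[of _ ?B] conjI)
  qed
qed

lemma continuous_eval:
  "continuous_map (subtopology (prod_topology \<C> K) {(\<theta>, x). fsrc \<theta> = q x}) K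
     (\<lambda>(\<theta>, x). ffun \<theta> x)"
  (is "continuous_map ?Z K ?ev")
  unfolding continuous_map_def
proof (intro conjI allI impI)
  have dom: "\<theta> \<in> fibre_maps K q G \<and> x \<in> fibre K q (fsrc \<theta>)" if "(\<theta>, x) \<in> topspace ?Z" for \<theta> x
    using that by (auto simp: fibre_def)
  show "?ev \<in> topspace ?Z \<rightarrow> topspace K"
    using dom fibre_mapsD(5) fibre_subset by fast
  fix W assume W: "openin K W"
  show "openin ?Z {z \<in> topspace ?Z. ?ev z \<in> W}"
  proof (subst openin_subopen, intro ballI)
    fix z assume z: "z \<in> {z \<in> topspace ?Z. ?ev z \<in> W}"
    obtain \<theta> x where zz: "z = (\<theta>, x)" by (cases z)
    then have t: "\<theta> \<in> fibre_maps K q G" "x \<in> fibre K q (fsrc \<theta>)" "ffun \<theta> x \<in> W"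
      using z dom by auto
    obtain V C where VC: "openin K V" "compactin K C" "x \<in> V" "V \<subseteq> C"
        "ffun \<theta> ` (C \<inter> fibre K q (fsrc \<theta>)) \<subseteq> W"
      using fibre_map_compact_neighbourhood[OF t(1,2) W t(3)] .
    let ?A = "{\<zeta> \<in> fibre_maps K q G. ffun \<zeta> ` (C \<inter> fibre K q (fsrc \<zeta>)) \<subseteq> W}"
    have "openin ?Z ((?A \<times> V) \<inter> {(\<theta>, x). fsrc \<theta> = q x})"
      using openin_compact_open_subbase[OF VC(2) W] VC(1)
      by (intro openin_subtopology_Int) (simp only: openin_prod_Times_iff, blast)
    moreover have "z \<in> (?A \<times> V) \<inter> {(\<theta>, x). fsrc \<theta> = q x}"
      using t VC zz by (auto simp: fibre_def)
    moreover have "(?A \<times> V) \<inter> {(\<theta>, x). fsrc \<theta> = q x} \<subseteq> {z \<in> topspace ?Z. ?ev z \<in> W}"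
    proof clarify
      fix \<zeta> y assume y: "\<zeta> \<in> fibre_maps K q G" "ffun \<zeta> ` (C \<inter> fibre K q (fsrc \<zeta>)) \<subseteq> W"
        "y \<in> V" "fsrc \<zeta> = q y"
      then have "y \<in> topspace K" using openin_subset[OF VC(1)] by blast
      then show "(\<zeta>, y) \<in> topspace ?Z \<and> ffun \<zeta> y \<in> W"
        using y VC(4) by (auto simp: fibre_def)
    qed
    ultimately show "\<exists>T. openin ?Z T \<and> z \<in> T \<and> T \<subseteq> {z \<in> topspace ?Z. ?ev z \<in> W}"
      by blast
  qed
qed

end

section \<open>From invariant pseudometrics to a compact groupoid\<close>

locale invariant_pseudometrics = groupoid_action K q G act
  for K :: "'k topology" and q :: "'k \<Rightarrow> 'g" and G :: "'g groupoid_data"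
    and act :: "'g \<Rightarrow> 'k \<Rightarrow> 'k" +
  fixes P :: "('k \<times> 'k \<Rightarrow> real) set"
  assumes P_continuous: "p \<in> P \<Longrightarrow>
      continuous_map (subtopology (prod_topology K K) {(x, y). q x = q y}) (top_of_set {0..}) p"
    and P_pseudometric: "u \<in> gunits G \<Longrightarrow> p \<in> P \<Longrightarrow> pseudometric_on (fibre K q u) p"
    and P_topology: "u \<in> gunits G \<Longrightarrow> pseudometric_topology (fibre K q u) P = fibre_space K q u"
    and P_invariant: "p \<in> P \<Longrightarrow> g \<in> garrows G \<Longrightarrow> x \<in> fibre K q (gsrc G g) \<Longrightarrow>
      y \<in> fibre K q (gsrc G g) \<Longrightarrow> p (act g x, act g y) = p (x, y)"
begin

text \<open>Points at distance zero lie in the same balls, hence in the same open sets of the Hausdorff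
  topology that the balls generate.\<close>

lemma P_separates:
  assumes u: "u \<in> gunits G" and x: "x \<in> fibre K q u" and y: "y \<in> fibre K q u"
    and zero: "\<And>p. p \<in> P \<Longrightarrow> p (x, y) = 0"
  shows "x = y"
proof (rule ccontr)
  assume "x \<noteq> y"
  then obtain V where V: "openin (fibre_space K q u) V" "x \<in> V" "y \<notin> V"
    using Hausdorff_fibre_space[of u] x y unfolding Hausdorff_space_def disjnt_iff
    by (metis topspace_fibre_space)
  let ?B = "insert (fibre K q u)
    {{y \<in> fibre K q u. p (x, y) < \<epsilon>} | p x \<epsilon>. p \<in> P \<and> x \<in> fibre K q u \<and> 0 < \<epsilon>}"
  have "generate_topology_on ?B V"
    using V(1) unfolding P_topology[OF u, symmetric] pseudometric_topology_def
    by (rule openin_topology_generated_by)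
  then have "x \<in> V \<longrightarrow> y \<in> V"
  proof induction
    case (Basis s)
    have "p (z, y) \<le> p (z, x)" if "p \<in> P" "z \<in> fibre K q u" for p z
      using P_pseudometric[OF u that(1)] zero[OF that(1)] that(2) x y
      unfolding pseudometric_on_def by (metis add.right_neutral)
    then have "p (z, y) < \<epsilon>" if "p \<in> P" "z \<in> fibre K q u" "p (z, x) < \<epsilon>" for p z \<epsilon>
      using that by fastforce
    with Basis y show ?case by auto
  qed auto
  with V show False by blast
qed

lemma P_near:
  assumes p: "p \<in> P" and a: "a \<in> topspace K" "a' \<in> topspace K" "q a = q a'" and e: "e > 0"
  obtains V V' where "openin K V" "openin K V'" "a \<in> V" "a' \<in> V'"
    "\<And>x x'. x \<in> V \<Longrightarrow> x' \<in> V' \<Longrightarrow> q x = q x' \<Longrightarrow> \<bar>p (x, x') - p (a, a')\<bar> < e"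
proof -
  let ?Z = "subtopology (prod_topology K K) {(x, y). q x = q y}"
  have "openin (top_of_set {0..}) ({0..} \<inter> ball (p (a, a')) e)"
    by (simp add: openin_open_Int)
  from openin_continuous_map_preimage[OF P_continuous[OF p] this]
  obtain N where N: "openin (prod_topology K K) N"
    "{z \<in> topspace ?Z. p z \<in> {0..} \<inter> ball (p (a, a')) e} = N \<inter> {(x, y). q x = q y}"
    unfolding openin_subtopology by blast
  have "p (a, a') \<ge> 0"
    using continuous_map_funspace[OF P_continuous[OF p]] a by auto
  then have "(a, a') \<in> N \<inter> {(x, y). q x = q y}"
    unfolding N(2)[symmetric] using a e by auto
  then have "(a, a') \<in> N" by simp
  then obtain V V' where V: "openin K V" "openin K V'" "a \<in> V" "a' \<in> V'" "V \<times> V' \<subseteq> N"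
    using N(1) unfolding openin_prod_topology_alt by metis
  show ?thesis
  proof (rule that[OF V(1-4)])
    fix x x' assume "x \<in> V" "x' \<in> V'" "q x = q x'"
    then have "(x, x') \<in> {z \<in> topspace ?Z. p z \<in> {0..} \<inter> ball (p (a, a')) e}"
      unfolding N(2) using V(5) by auto
    then show "\<bar>p (x, x') - p (a, a')\<bar> < e"
      by (auto simp: dist_real_def abs_minus_commute)
  qed
qed

definition isometries :: "('g, 'k) fibre_map set" where
  "isometries = {\<theta> \<in> fibre_maps K q G. ffun \<theta> ` fibre K q (fsrc \<theta>) = fibre K q (frng \<theta>) \<and>
     (\<forall>p\<in>P. \<forall>x\<in>fibre K q (fsrc \<theta>). \<forall>y\<in>fibre K q (fsrc \<theta>). p (ffun \<theta> x, ffun \<theta> y) = p (x, y))}"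

lemma isometriesD:
  assumes "\<theta> \<in> isometries"
  shows "\<theta> \<in> fibre_maps K q G" "ffun \<theta> ` fibre K q (fsrc \<theta>) = fibre K q (frng \<theta>)"
    "p \<in> P \<Longrightarrow> x \<in> fibre K q (fsrc \<theta>) \<Longrightarrow> y \<in> fibre K q (fsrc \<theta>) \<Longrightarrow>
      p (ffun \<theta> x, ffun \<theta> y) = p (x, y)"
  using assms unfolding isometries_def by blast+

lemma P_diag:
  assumes "p \<in> P" "x \<in> topspace K" shows "p (x, x) = 0"
proof -
  have "x \<in> fibre K q (q x)" using assms(2) by (simp add: fibre_def)
  then show ?thesis
    using P_pseudometric[OF q_in_gunits[OF assms(2)] assms(1)]
    unfolding pseudometric_on_def by blast
qed

lemma isometry_bij_betw:
  assumes t: "\<theta> \<in> isometries"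
  shows "bij_betw (ffun \<theta>) (fibre K q (fsrc \<theta>)) (fibre K q (frng \<theta>))"
  unfolding bij_betw_def
proof
  show "inj_on (ffun \<theta>) (fibre K q (fsrc \<theta>))"
  proof (rule inj_onI)
    fix x y assume xy: "x \<in> fibre K q (fsrc \<theta>)" "y \<in> fibre K q (fsrc \<theta>)" "ffun \<theta> x = ffun \<theta> y"
    have "ffun \<theta> y \<in> topspace K"
      using fibre_mapsD(5)[OF isometriesD(1)[OF t] xy(2)] fibre_subset[of K q] by blast
    then have "p (x, y) = 0" if "p \<in> P" for p
      using isometriesD(3)[OF t that xy(1,2)] xy(3) P_diag[OF that] by simp
    then show "x = y"
      using P_separates fibre_mapsD(1)[OF isometriesD(1)[OF t]] xy(1,2) by blast
  qed
qed (rule isometriesD(2)[OF t])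

text \<open>An Arzela-Ascoli theorem with moving domains. The limit of an ultrafilter of isometries is
  obtained from the limit \<open>L\<close> of their graphs in \<open>K \<times> K\<close>: isometry of the maps carries over to
  \<open>L\<close>, which makes \<open>L\<close> the graph of an isometry between the limit fibres.\<close>

lemma compact_isometries: "compact_space (subtopology \<C> isometries)"
proof (rule compact_space_if_ultrafilter_limits)
  fix F assume F: "ultrafilter F"
    and "eventually (\<lambda>\<theta>. \<theta> \<in> topspace (subtopology \<C> isometries)) F"
  then have S: "eventually (\<lambda>\<theta>. \<theta> \<in> isometries) F"
    by (elim eventually_mono) auto
  have fm: "eventually (\<lambda>\<theta>. \<theta> \<in> fibre_maps K q G) F"
    using S by eventually_elim (rule isometriesD(1))
  have "eventually (\<lambda>\<theta>. fsrc \<theta> \<in> topspace (unit_space G)) F"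
    using fm by eventually_elim (simp add: fibre_mapsD(1))
  then obtain u where u: "limitin (unit_space G) fsrc u F"
    using ultrafilter_limitin_compact[OF F compact_unit_space] by blast
  have "eventually (\<lambda>\<theta>. frng \<theta> \<in> topspace (unit_space G)) F"
    using fm by eventually_elim (simp add: fibre_mapsD(2))
  then obtain v where v: "limitin (unit_space G) frng v F"
    using ultrafilter_limitin_compact[OF F compact_unit_space] by blast
  have uG: "u \<in> gunits G" and vG: "v \<in> gunits G"
    using limitin_topspace[OF u] limitin_topspace[OF v] by auto
  have evex: "\<exists>\<theta>. \<theta> \<in> isometries \<and> Q \<theta>" if "eventually Q F" for Q
    using ultrafilter_ex[OF F eventually_conj[OF S that]] .
  define graph where "graph \<theta> = (\<lambda>x. (x, ffun \<theta> x)) ` fibre K q (fsrc \<theta>)" for \<theta> :: "('g, 'k) fibre_map"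
  define L where "L = set_limit (prod_topology K K) F graph"
  have cKK: "compact_space (prod_topology K K)"
    using compact_K by (simp add: compact_space_prod_topology)
  have cL: "closedin (prod_topology K K) L"
    unfolding L_def by (rule closedin_set_limit)
  have LK: "a \<in> topspace K" "b \<in> topspace K" if "(a, b) \<in> L" for a b
    using that closedin_subset[OF cL] by auto
  have meet: "eventually (\<lambda>\<theta>. \<exists>x\<in>fibre K q (fsrc \<theta>). x \<in> V \<and> ffun \<theta> x \<in> W) F"
    if "(a, b) \<in> L" "openin K V" "openin K W" "a \<in> V" "b \<in> W" for a b V W
  proof -
    have "eventually (\<lambda>\<theta>. graph \<theta> \<inter> V \<times> W \<noteq> {}) F"
      using that unfolding L_def
      by (intro set_limitD[of "(a, b)"]) (auto simp: openin_prod_Times_iff)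
    then show ?thesis
      by eventually_elim (auto simp: graph_def)
  qed
  have avoid: "eventually (\<lambda>\<theta>. \<forall>x\<in>fibre K q (fsrc \<theta>). \<not> (x \<in> C \<and> ffun \<theta> x \<in> D)) F"
    if "closedin K C" "closedin K D" "(C \<times> D) \<inter> L = {}" for C D
  proof -
    have "eventually (\<lambda>\<theta>. graph \<theta> \<inter> C \<times> D = {}) F"
      using that unfolding L_def
      by (intro set_limit_eventually_disjoint[OF F cKK]) (auto simp: closedin_prod_Times_iff)
    then show ?thesis
      by eventually_elim (auto simp: graph_def)
  qed
  have nq: "openin K {x \<in> topspace K. q x \<in> N}" if "openin (unit_space G) N" for N
    using openin_continuous_map_preimage[OF continuous_q that] .
  have Lq: "q a = u" "q b = v" if ab: "(a, b) \<in> L" for a b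
  proof -
    show "q a = u"
    proof (rule ccontr)
      assume "q a \<noteq> u"
      then obtain N N' where N: "openin (unit_space G) N" "openin (unit_space G) N'"
        "q a \<in> N" "u \<in> N'" "disjnt N N'"
        using Hausdorff_unit_space q_in_gunits[OF LK(1)[OF ab]] uG
        unfolding Hausdorff_space_def topspace_unit_space by metis
      have "eventually (\<lambda>\<theta>. (\<exists>x\<in>fibre K q (fsrc \<theta>). x \<in> {x \<in> topspace K. q x \<in> N} \<and>
          ffun \<theta> x \<in> topspace K) \<and> fsrc \<theta> \<in> N') F"
        using meet[OF ab nq[OF N(1)] openin_topspace] LK[OF ab] N(3) limitinD[OF u N(2,4)]
        by (intro eventually_conj) auto
      then show False
        using evex N(5) by (fastforce simp: fibre_def disjnt_iff)
    qed
    show "q b = v"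
    proof (rule ccontr)
      assume "q b \<noteq> v"
      then obtain N N' where N: "openin (unit_space G) N" "openin (unit_space G) N'"
        "q b \<in> N" "v \<in> N'" "disjnt N N'"
        using Hausdorff_unit_space q_in_gunits[OF LK(2)[OF ab]] vG
        unfolding Hausdorff_space_def topspace_unit_space by metis
      have "eventually (\<lambda>\<theta>. (\<exists>x\<in>fibre K q (fsrc \<theta>). x \<in> topspace K \<and>
          ffun \<theta> x \<in> {x \<in> topspace K. q x \<in> N}) \<and> frng \<theta> \<in> N') F"
        using meet[OF ab openin_topspace nq[OF N(1)]] LK[OF ab] N(3) limitinD[OF v N(2,4)]
        by (intro eventually_conj) auto
      from evex[OF this] obtain \<theta> x where \<theta>: "\<theta> \<in> isometries" "x \<in> fibre K q (fsrc \<theta>)"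
        "q (ffun \<theta> x) \<in> N" "frng \<theta> \<in> N'" by blast
      then have "q (ffun \<theta> x) = frng \<theta>"
        using fibre_mapsD(5)[OF isometriesD(1)[OF \<theta>(1)] \<theta>(2)] by (simp add: fibre_def)
      with \<theta> N(5) show False by (auto simp: disjnt_iff)
    qed
  qed
  \<comment> \<open>Points of \<open>L\<close> are approximated by points on the graph of one and the same isometry.\<close>
  have Lp: "p (b, b') = p (a, a')" if p: "p \<in> P" and ab: "(a, b) \<in> L" "(a', b') \<in> L" for p a b a' b'
  proof (rule ccontr)
    assume ne: "p (b, b') \<noteq> p (a, a')"
    define e where "e = \<bar>p (b, b') - p (a, a')\<bar> / 2"
    have e: "e > 0" using ne by (simp add: e_def)
    obtain V V' where V: "openin K V" "openin K V'" "a \<in> V" "a' \<in> V'"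
      "\<And>x x'. x \<in> V \<Longrightarrow> x' \<in> V' \<Longrightarrow> q x = q x' \<Longrightarrow> \<bar>p (x, x') - p (a, a')\<bar> < e"
      using P_near[OF p LK(1)[OF ab(1)] LK(1)[OF ab(2)] _ e] Lq(1) ab by metis
    obtain W W' where W: "openin K W" "openin K W'" "b \<in> W" "b' \<in> W'"
      "\<And>x x'. x \<in> W \<Longrightarrow> x' \<in> W' \<Longrightarrow> q x = q x' \<Longrightarrow> \<bar>p (x, x') - p (b, b')\<bar> < e"
      using P_near[OF p LK(2)[OF ab(1)] LK(2)[OF ab(2)] _ e] Lq(2) ab by metis
    have "eventually (\<lambda>\<theta>. (\<exists>x\<in>fibre K q (fsrc \<theta>). x \<in> V \<and> ffun \<theta> x \<in> W) \<and>
        (\<exists>x\<in>fibre K q (fsrc \<theta>). x \<in> V' \<and> ffun \<theta> x \<in> W')) F"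
      by (intro eventually_conj meet[OF ab(1)] meet[OF ab(2)] V W)
    from evex[OF this] obtain \<theta> x x' where \<theta>: "\<theta> \<in> isometries" "x \<in> fibre K q (fsrc \<theta>)"
      "x' \<in> fibre K q (fsrc \<theta>)" "x \<in> V" "x' \<in> V'" "ffun \<theta> x \<in> W" "ffun \<theta> x' \<in> W'" by blast
    have "q x = q x'" using \<theta> by (simp add: fibre_def)
    moreover have "q (ffun \<theta> x) = q (ffun \<theta> x')"
      using fibre_mapsD(5)[OF isometriesD(1)[OF \<theta>(1)]] \<theta>(2,3) by (simp add: fibre_def)
    ultimately have "\<bar>p (x, x') - p (a, a')\<bar> < e" "\<bar>p (ffun \<theta> x, ffun \<theta> x') - p (b, b')\<bar> < e"
      using V(5) W(5) \<theta> by blast+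
    moreover have "p (ffun \<theta> x, ffun \<theta> x') = p (x, x')"
      using isometriesD(3)[OF \<theta>(1) p \<theta>(2,3)] .
    ultimately show False unfolding e_def by (smt (verit) field_sum_of_halves)
  qed
  have reg: "\<exists>V C. openin K V \<and> closedin K C \<and> a \<in> V \<and> V \<subseteq> C \<and> C \<inter> A = {}"
    if "closedin K A" "a \<in> topspace K" "a \<notin> A" for a A
  proof -
    have "openin K (topspace K - A)" using that(1) by blast
    moreover have "a \<in> topspace K - A" using that by blast
    ultimately obtain V C where "openin K V" "closedin K C" "a \<in> V" "V \<subseteq> C" "C \<subseteq> topspace K - A"
      by (rule closed_neighbourhood)
    then show ?thesis by blast
  qed
  have cfst: "closedin K (fst ` A)" and csnd: "closedin K (snd ` A)"
    if "closedin (prod_topology K K) A" for A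
    using closed_map_fst[OF compact_K, of K] closed_map_snd[OF compact_K, of K] that
    unfolding closed_map_def by blast+
  have near_fibre: "eventually (\<lambda>\<theta>. r \<theta> \<in> q ` V) F"
    if "limitin (unit_space G) r (q a) F" "openin K V" "a \<in> V" for r a V
    using limitinD[OF that(1), of "q ` V"] open_q that(2,3) unfolding open_map_def by blast
  \<comment> \<open>If \<open>L\<close> has no point above \<open>a\<close>, the graphs eventually avoid a neighbourhood of the line over
    \<open>a\<close>; but \<open>q\<close> is open, so the source fibres eventually meet that neighbourhood of \<open>a\<close>.\<close>
  have Ldom: "\<exists>b. (a, b) \<in> L" if a: "a \<in> fibre K q u" for a
  proof (rule ccontr)
    assume "\<nexists>b. (a, b) \<in> L"
    then have nL: "a \<notin> fst ` L" by force
    have "a \<in> topspace K" using a by (simp add: fibre_def)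
    from reg[OF cfst[OF cL] this nL]
    obtain V C where V: "openin K V" "closedin K C" "a \<in> V" "V \<subseteq> C" "C \<inter> fst ` L = {}"
      by metis
    have "(C \<times> topspace K) \<inter> L = {}" using V(5) by force
    from avoid[OF V(2) closedin_topspace this]
    have "eventually (\<lambda>\<theta>. (\<forall>x\<in>fibre K q (fsrc \<theta>). \<not> (x \<in> C \<and> ffun \<theta> x \<in> topspace K)) \<and>
        fsrc \<theta> \<in> q ` V) F"
      using near_fibre[OF _ V(1,3)] u a by (intro eventually_conj) (auto simp: fibre_def)
    from evex[OF this] obtain \<theta> x where \<theta>: "\<theta> \<in> isometries" "x \<in> V" "fsrc \<theta> = q x"
      "\<forall>x\<in>fibre K q (fsrc \<theta>). \<not> (x \<in> C \<and> ffun \<theta> x \<in> topspace K)" by blast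
    then have "x \<in> fibre K q (fsrc \<theta>)"
      using openin_subset[OF V(1)] by (auto simp: fibre_def)
    with \<theta> V(4) show False
      using fibre_mapsD(5)[OF isometriesD(1)[OF \<theta>(1)]] fibre_subset[of K q] by blast
  qed
  \<comment> \<open>The same argument on the range side uses that the isometries are onto.\<close>
  have Lran: "\<exists>a. (a, b) \<in> L" if b: "b \<in> fibre K q v" for b
  proof (rule ccontr)
    assume "\<nexists>a. (a, b) \<in> L"
    then have nL: "b \<notin> snd ` L" by force
    have "b \<in> topspace K" using b by (simp add: fibre_def)
    from reg[OF csnd[OF cL] this nL]
    obtain V C where V: "openin K V" "closedin K C" "b \<in> V" "V \<subseteq> C" "C \<inter> snd ` L = {}"
      by metis
    have "(topspace K \<times> C) \<inter> L = {}" using V(5) by force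
    from avoid[OF closedin_topspace V(2) this]
    have "eventually (\<lambda>\<theta>. (\<forall>x\<in>fibre K q (fsrc \<theta>). \<not> (x \<in> topspace K \<and> ffun \<theta> x \<in> C)) \<and>
        frng \<theta> \<in> q ` V) F"
      using near_fibre[OF _ V(1,3)] v b by (intro eventually_conj) (auto simp: fibre_def)
    from evex[OF this] obtain \<theta> y where \<theta>: "\<theta> \<in> isometries" "y \<in> V" "frng \<theta> = q y"
      "\<forall>x\<in>fibre K q (fsrc \<theta>). \<not> (x \<in> topspace K \<and> ffun \<theta> x \<in> C)" by blast
    then have "y \<in> fibre K q (frng \<theta>)"
      using openin_subset[OF V(1)] by (auto simp: fibre_def)
    then obtain x where "x \<in> fibre K q (fsrc \<theta>)" "y = ffun \<theta> x"
      using isometriesD(2)[OF \<theta>(1)] by blast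
    with \<theta> V(4) show False using fibre_subset[of K q] by blast
  qed
  have Lfun: "b = b'" if ab: "(a, b) \<in> L" "(a, b') \<in> L" for a b b'
  proof (rule P_separates[OF vG])
    show "b \<in> fibre K q v" "b' \<in> fibre K q v"
      using ab LK Lq by (auto simp: fibre_def)
    show "p (b, b') = 0" if "p \<in> P" for p
      using Lp[OF that ab] P_diag[OF that LK(1)[OF ab(1)]] by simp
  qed
  define f where "f = restrict (\<lambda>a. SOME b. (a, b) \<in> L) (fibre K q u)"
  have fL: "(a, f a) \<in> L" if "a \<in> fibre K q u" for a
    using someI_ex[OF Ldom[OF that]] that by (simp add: f_def)
  have L_iff: "(a, b) \<in> L \<longleftrightarrow> a \<in> fibre K q u \<and> b = f a" for a b
    using fL Lfun Lq(1) LK(1) by (auto simp: fibre_def)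
  have f_fibre: "f a \<in> fibre K q v" if "a \<in> fibre K q u" for a
    using fL[OF that] Lq(2) LK(2) by (auto simp: fibre_def)
  define \<theta>0 where "\<theta>0 = Fibre_Map u v f"
  \<comment> \<open>A closed graph in a compact product: preimages of closed sets are projections of closed sets.\<close>
  have fcont: "continuous_map (fibre_space K q u) (fibre_space K q v) f"
    unfolding continuous_map_closedin
  proof (intro conjI allI impI)
    show "f \<in> topspace (fibre_space K q u) \<rightarrow> topspace (fibre_space K q v)"
      using f_fibre by simp
    fix D assume "closedin (fibre_space K q v) D"
    then have "closedin K D"
      unfolding fibre_space_def using closedin_closed_subtopology[OF closedin_fibre[OF vG]] by blast
    then have "closedin (prod_topology K K) (L \<inter> topspace K \<times> D)"
      by (intro closedin_Int cL) (simp add: closedin_prod_Times_iff)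
    then have "closedin K (fst ` (L \<inter> topspace K \<times> D))" by (rule cfst)
    moreover have "fst ` (L \<inter> topspace K \<times> D) = {x \<in> fibre K q u. f x \<in> D}"
    proof
      show "fst ` (L \<inter> topspace K \<times> D) \<subseteq> {x \<in> fibre K q u. f x \<in> D}"
        by (auto simp: L_iff)
      show "{x \<in> fibre K q u. f x \<in> D} \<subseteq> fst ` (L \<inter> topspace K \<times> D)"
      proof clarify
        fix x assume "x \<in> fibre K q u" "f x \<in> D"
        then show "x \<in> fst ` (L \<inter> topspace K \<times> D)"
          using fL LK(1) by (intro image_eqI[of _ _ "(x, f x)"]) auto
      qed
    qed
    ultimately have "closedin K {x \<in> fibre K q u. f x \<in> D}" by simp
    then show "closedin (fibre_space K q u) {x \<in> topspace (fibre_space K q u). f x \<in> D}"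
      unfolding topspace_fibre_space unfolding fibre_space_def
      by (subst closedin_closed_subtopology[OF closedin_fibre[OF uG]]) blast
  qed
  have \<theta>0_fm: "\<theta>0 \<in> fibre_maps K q G"
    by (rule fibre_mapsI) (use uG vG fcont in \<open>auto simp: \<theta>0_def f_def\<close>)
  have \<theta>0_iso: "\<theta>0 \<in> isometries"
    unfolding isometries_def
  proof (intro CollectI conjI ballI \<theta>0_fm)
    show "ffun \<theta>0 ` fibre K q (fsrc \<theta>0) = fibre K q (frng \<theta>0)"
      using f_fibre Lran L_iff by (fastforce simp: \<theta>0_def)
    show "p (ffun \<theta>0 x, ffun \<theta>0 y) = p (x, y)"
      if "p \<in> P" "x \<in> fibre K q (fsrc \<theta>0)" "y \<in> fibre K q (fsrc \<theta>0)" for p x y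
      using that Lp fL by (simp add: \<theta>0_def)
  qed
  have "limitin \<C> (\<lambda>\<theta>. \<theta>) \<theta>0 F"
    unfolding compact_open_topology_def
  proof (rule limitin_topology_generated_by)
    let ?\<S> = "{{\<theta> \<in> fibre_maps K q G. ffun \<theta> ` (C \<inter> fibre K q (fsrc \<theta>)) \<subseteq> U} | C U.
          compactin K C \<and> openin K U}"
    show "\<theta>0 \<in> \<Union>?\<S>"
      using \<theta>0_fm topspace_compact_open_topology[of K q G]
      unfolding compact_open_topology_def topology_generated_by_topspace by blast
    fix V assume "V \<in> ?\<S>" and \<theta>0: "\<theta>0 \<in> V"
    then obtain C U where V: "V = {\<theta> \<in> fibre_maps K q G. ffun \<theta> ` (C \<inter> fibre K q (fsrc \<theta>)) \<subseteq> U}"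
      "compactin K C" "openin K U" by blast
    have "closedin K C" using V(2) Hausdorff_K by (rule compactin_imp_closedin[rotated])
    moreover have "closedin K (topspace K - U)" using V(3) by blast
    moreover have "(C \<times> (topspace K - U)) \<inter> L = {}"
      using \<theta>0 by (auto simp: V(1) \<theta>0_def L_iff image_subset_iff)
    ultimately have "eventually (\<lambda>\<theta>. \<forall>x\<in>fibre K q (fsrc \<theta>).
        \<not> (x \<in> C \<and> ffun \<theta> x \<in> topspace K - U)) F"
      by (rule avoid)
    with fm show "eventually (\<lambda>\<theta>. \<theta> \<in> V) F"
    proof eventually_elim
      case (elim \<theta>)
      have "ffun \<theta> x \<in> U" if x: "x \<in> C \<inter> fibre K q (fsrc \<theta>)" for x
        using elim x fibre_mapsD(5)[OF elim(1), of x] by (auto simp: fibre_def)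
      then show ?case unfolding V(1) using elim(1) by (simp add: image_subset_iff)
    qed
  qed
  then have "limitin (subtopology \<C> isometries) (\<lambda>\<theta>. \<theta>) \<theta>0 F"
    using \<theta>0_iso S by (simp add: limitin_subtopology)
  then show "\<exists>l. limitin (subtopology \<C> isometries) (\<lambda>\<theta>. \<theta>) l F" by blast
qed

lemma closedin_isometries: "closedin \<C> isometries"
proof (rule compactin_imp_closedin[OF Hausdorff_compact_open])
  show "compactin \<C> isometries"
    unfolding compactin_subspace topspace_compact_open_topology
    using compact_isometries by (simp add: isometries_def)
qed

text \<open>A continuous bijection between the compact Hausdorff fibres is a homeomorphism.\<close>

lemma fibre_inverse_isometry:
  assumes t: "\<theta> \<in> isometries"
  shows "fibre_inverse K q \<theta> \<in> isometries"
proof -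
  let ?A = "fibre K q (fsrc \<theta>)" and ?B = "fibre K q (frng \<theta>)" and ?\<eta> = "fibre_inverse K q \<theta>"
  note fm = fibre_mapsD[OF isometriesD(1)[OF t]]
  have bij: "bij_betw (ffun \<theta>) ?A ?B" by (rule isometry_bij_betw[OF t])
  have sel [simp]: "fsrc ?\<eta> = frng \<theta>" "frng ?\<eta> = fsrc \<theta>"
    "ffun ?\<eta> = restrict (inv_into ?A (ffun \<theta>)) ?B"
    by (simp_all add: fibre_inverse_def)
  have "homeomorphic_map (fibre_space K q (fsrc \<theta>)) (fibre_space K q (frng \<theta>)) (ffun \<theta>)"
    using bij compact_fibre_space[OF fm(1)] Hausdorff_fibre_space fm(4)
    by (intro continuous_imp_homeomorphic_map) (auto simp: bij_betw_def)
  then obtain g where g: "homeomorphic_maps (fibre_space K q (fsrc \<theta>)) (fibre_space K q (frng \<theta>)) (ffun \<theta>) g"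
    using homeomorphic_map_maps by blast
  have gc: "continuous_map (fibre_space K q (frng \<theta>)) (fibre_space K q (fsrc \<theta>)) g"
    using g unfolding homeomorphic_maps_def by blast
  have gA: "g y \<in> ?A" if "y \<in> ?B" for y
    using continuous_map_funspace[OF gc] that by (simp add: Pi_iff)
  have gB: "ffun \<theta> (g y) = y" if "y \<in> ?B" for y
    using g that unfolding homeomorphic_maps_def by simp
  have inv_g: "inv_into ?A (ffun \<theta>) y = g y" if y: "y \<in> ?B" for y
    using inv_into_f_f[OF bij_betw_imp_inj_on[OF bij] gA[OF y]] gB[OF y] by simp
  have cont: "continuous_map (fibre_space K q (frng \<theta>)) (fibre_space K q (fsrc \<theta>))
      (restrict (inv_into ?A (ffun \<theta>)) ?B)"
    by (rule continuous_map_eq[OF gc]) (simp add: inv_g)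
  show ?thesis
    unfolding isometries_def
  proof (intro CollectI conjI ballI)
    show "?\<eta> \<in> fibre_maps K q G"
      by (rule fibre_mapsI) (use fm(1,2) cont in auto)
    show "ffun ?\<eta> ` fibre K q (fsrc ?\<eta>) = fibre K q (frng ?\<eta>)"
      using bij_betw_imp_surj_on[OF bij_betw_inv_into[OF bij]] by simp
    fix p x y assume p: "p \<in> P" and xy: "x \<in> fibre K q (fsrc ?\<eta>)" "y \<in> fibre K q (fsrc ?\<eta>)"
    then have "x \<in> ?B" "y \<in> ?B" by auto
    then show "p (ffun ?\<eta> x, ffun ?\<eta> y) = p (x, y)"
      using isometriesD(3)[OF t p gA gA, of x y] by (simp add: inv_g gB)
  qed
qed

text \<open>For a bijection, \<open>\<theta>\<close> pulls \<open>C\<close> back into \<open>V\<close> iff it pushes the complement of \<open>V\<close> off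
  \<open>C\<close>. In a compact Hausdorff space complements exchange open and compact sets, which makes
  inversion continuous for the compact-open topology.\<close>

lemma fibre_inverse_subbase_iff:
  assumes t: "\<theta> \<in> isometries" and C: "C \<subseteq> topspace K"
  shows "ffun (fibre_inverse K q \<theta>) ` (C \<inter> fibre K q (frng \<theta>)) \<subseteq> V \<longleftrightarrow>
    ffun \<theta> ` ((topspace K - V) \<inter> fibre K q (fsrc \<theta>)) \<subseteq> topspace K - C"
  (is "?l \<longleftrightarrow> ?r")
proof -
  let ?A = "fibre K q (fsrc \<theta>)" and ?B = "fibre K q (frng \<theta>)"
  have bij: "bij_betw (ffun \<theta>) ?A ?B" by (rule isometry_bij_betw[OF t])
  have inv: "ffun (fibre_inverse K q \<theta>) (ffun \<theta> x) = x" if "x \<in> ?A" for x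
    using that bij bij_betwE[OF bij]
    by (simp add: fibre_inverse_def bij_betw_inv_into_left)
  have "?l \<longleftrightarrow> (\<forall>y\<in>?B. y \<in> C \<longrightarrow> ffun (fibre_inverse K q \<theta>) y \<in> V)" by auto
  also have "\<dots> \<longleftrightarrow> (\<forall>x\<in>?A. ffun \<theta> x \<in> C \<longrightarrow> x \<in> V)"
    unfolding bij_betw_imp_surj_on[OF bij, symmetric] using inv by auto
  also have "\<dots> \<longleftrightarrow> ?r"
    using bij_betwE[OF bij] C fibre_subset[of K q "fsrc \<theta>"] fibre_subset[of K q "frng \<theta>"]
    unfolding image_subset_iff by (auto simp: subset_iff)
  finally show ?thesis .
qed

lemma continuous_fibre_inverse:
  "continuous_map (subtopology \<C> isometries) (subtopology \<C> isometries) (fibre_inverse K q)"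
proof -
  let ?S = "subtopology \<C> isometries"
  have tS: "topspace ?S = isometries" using isometriesD(1) by auto
  have "continuous_map ?S \<C> (fibre_inverse K q)"
    unfolding compact_open_topology_def[of K q G]
  proof (rule continuous_on_generated_topo, unfold compact_open_topology_def[of K q G, symmetric] tS)
    show "fibre_inverse K q ` isometries
        \<subseteq> \<Union>{{\<theta> \<in> fibre_maps K q G. ffun \<theta> ` (C \<inter> fibre K q (fsrc \<theta>)) \<subseteq> U} |C U.
            compactin K C \<and> openin K U}"
      using fibre_inverse_isometry isometriesD(1)
      unfolding topology_generated_by_topspace[symmetric] compact_open_topology_def[symmetric]
        topspace_compact_open_topology by blast
    fix U assume "U \<in> {{\<theta> \<in> fibre_maps K q G. ffun \<theta> ` (C \<inter> fibre K q (fsrc \<theta>)) \<subseteq> U} |C U.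
            compactin K C \<and> openin K U}"
    then obtain C V where U: "U = {\<theta> \<in> fibre_maps K q G. ffun \<theta> ` (C \<inter> fibre K q (fsrc \<theta>)) \<subseteq> V}"
      and CV: "compactin K C" "openin K V" by blast
    let ?N = "{\<theta> \<in> fibre_maps K q G. ffun \<theta> ` ((topspace K - V) \<inter> fibre K q (fsrc \<theta>)) \<subseteq> topspace K - C}"
    have "compactin K (topspace K - V)"
      using CV(2) compact_K closedin_compact_space by blast
    moreover have "openin K (topspace K - C)"
      using compactin_imp_closedin[OF Hausdorff_K CV(1)] by blast
    ultimately have "openin \<C> ?N" by (rule openin_compact_open_subbase)
    then have "openin ?S (?N \<inter> isometries)" by (rule openin_subtopology_Int)
    moreover have "fibre_inverse K q -` U \<inter> isometries = ?N \<inter> isometries"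
    proof (intro set_eqI)
      fix \<theta>
      show "\<theta> \<in> fibre_inverse K q -` U \<inter> isometries \<longleftrightarrow> \<theta> \<in> ?N \<inter> isometries"
        using fibre_inverse_subbase_iff[OF _ compactin_subset_topspace[OF CV(1)], of \<theta> V]
          isometriesD(1)[of \<theta>] isometriesD(1)[OF fibre_inverse_isometry, of \<theta>]
        by (auto simp: U fibre_inverse_def)
    qed
    ultimately show "openin ?S (fibre_inverse K q -` U \<inter> isometries)" by simp
  qed
  then show ?thesis
    using fibre_inverse_isometry tS by (auto simp: continuous_map_in_subtopology)
qed

lemma act_map_isometry:
  assumes g: "g \<in> garrows G"
  shows "act_map K q G act g \<in> isometries"
proof -
  have sr: "gsrc G (ginv G g) = grng G g"
    using inv_inv[OF g] by (simp add: gsrc_def grng_def)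
  have "fibre K q (grng G g) \<subseteq> act g ` fibre K q (gsrc G g)"
  proof
    fix y assume y: "y \<in> fibre K q (grng G g)"
    let ?x = "act (ginv G g) y"
    have yK: "y \<in> topspace K" "q y = grng G g" using y by (auto simp: fibre_def)
    have x: "?x \<in> fibre K q (gsrc G g)"
      using fibre_mapsD(5)[OF act_map_in_fibre_maps[OF inv_closed[OF g]], of y] y inv_inv[OF g]
      by (simp add: act_map_def sr) (simp add: gsrc_def grng_def)
    have "act g ?x = act (gmult G g (ginv G g)) y"
      using g yK inv_closed[OF g] inv_inv[OF g] sr
      by (intro act_mult[symmetric]) (simp_all add: gsrc_def grng_def)
    also have "\<dots> = y"
      using act_unit[OF grng_in_gunits[OF g] y] by (simp add: grng_def)
    finally show "y \<in> act g ` fibre K q (gsrc G g)"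
      using x by (intro image_eqI[of _ _ ?x]) simp_all
  qed
  moreover have "act g ` fibre K q (gsrc G g) \<subseteq> fibre K q (grng G g)"
    using fibre_mapsD(5)[OF act_map_in_fibre_maps[OF g]] by (auto simp: act_map_def)
  ultimately show ?thesis
    using act_map_in_fibre_maps[OF g] P_invariant[OF _ g]
    by (auto simp: isometries_def act_map_def)
qed

lemma fibre_comp_isometry:
  assumes t: "\<theta> \<in> isometries" and e: "\<eta> \<in> isometries" and c: "frng \<eta> = fsrc \<theta>"
  shows "fibre_comp K q \<theta> \<eta> \<in> isometries"
proof -
  let ?A = "fibre K q (fsrc \<eta>)"
  have [simp]: "fsrc (fibre_comp K q \<theta> \<eta>) = fsrc \<eta>" "frng (fibre_comp K q \<theta> \<eta>) = frng \<theta>"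
    "ffun (fibre_comp K q \<theta> \<eta>) = compose ?A (ffun \<theta>) (ffun \<eta>)"
    by (simp_all add: fibre_comp_def)
  have mem: "ffun \<eta> x \<in> fibre K q (fsrc \<theta>)" if "x \<in> ?A" for x
    using fibre_mapsD(5)[OF isometriesD(1)[OF e] that] c by simp
  show ?thesis
    unfolding isometries_def
  proof (intro CollectI conjI ballI)
    show "fibre_comp K q \<theta> \<eta> \<in> fibre_maps K q G"
      using fibre_comp_in_fibre_maps isometriesD(1) t e c by blast
    have "compose ?A (ffun \<theta>) (ffun \<eta>) ` ?A = ffun \<theta> ` (ffun \<eta> ` ?A)"
      unfolding image_image by (intro image_cong) (simp_all add: compose_def)
    then show "ffun (fibre_comp K q \<theta> \<eta>) ` fibre K q (fsrc (fibre_comp K q \<theta> \<eta>)) =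
        fibre K q (frng (fibre_comp K q \<theta> \<eta>))"
      using isometriesD(2)[OF t] isometriesD(2)[OF e] c by simp
    show "p (ffun (fibre_comp K q \<theta> \<eta>) x, ffun (fibre_comp K q \<theta> \<eta>) y) = p (x, y)"
      if "p \<in> P" "x \<in> fibre K q (fsrc (fibre_comp K q \<theta> \<eta>))"
        "y \<in> fibre K q (fsrc (fibre_comp K q \<theta> \<eta>))" for p x y
      using that isometriesD(3)[OF t that(1) mem mem] isometriesD(3)[OF e that(1)]
      by (simp add: compose_def)
  qed
qed

lemma fibre_inverse_comp:
  assumes t: "\<theta> \<in> isometries" and e: "\<eta> \<in> isometries" and c: "frng \<eta> = fsrc \<theta>"
  shows "fibre_inverse K q (fibre_comp K q \<theta> \<eta>) =
    fibre_comp K q (fibre_inverse K q \<eta>) (fibre_inverse K q \<theta>)"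
proof -
  let ?A = "fibre K q (fsrc \<eta>)" and ?B = "fibre K q (fsrc \<theta>)" and ?C = "fibre K q (frng \<theta>)"
  let ?h = "compose ?A (ffun \<theta>) (ffun \<eta>)"
  have bt: "bij_betw (ffun \<theta>) ?B ?C" and be: "bij_betw (ffun \<eta>) ?A ?B"
    using isometry_bij_betw[OF t] isometry_bij_betw[OF e] c by simp_all
  have bh: "bij_betw ?h ?A ?C"
    using isometry_bij_betw[OF fibre_comp_isometry[OF t e c]] by (simp add: fibre_comp_def)
  have "restrict (inv_into ?A ?h) ?C y =
      compose ?C (restrict (inv_into ?A (ffun \<eta>)) ?B) (restrict (inv_into ?B (ffun \<theta>)) ?C) y" for y
  proof (cases "y \<in> ?C")
    case True
    then obtain x where x: "x \<in> ?A" "y = ?h x"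
      using bij_betw_imp_surj_on[OF bh] by blast
    then have "y = ffun \<theta> (ffun \<eta> x)" "ffun \<eta> x \<in> ?B"
      using bij_betwE[OF be] by (simp_all add: compose_def)
    then show ?thesis
      using True x bij_betw_inv_into_left[OF bh x(1)] bij_betw_inv_into_left[OF be x(1)]
        bij_betw_inv_into_left[OF bt, of "ffun \<eta> x"] by (simp add: compose_def)
  qed (simp add: compose_def)
  then show ?thesis
    using c by (auto simp: fibre_inverse_def fibre_comp_def)
qed

lemma fibre_inverse_act_map:
  assumes g: "g \<in> garrows G"
  shows "fibre_inverse K q (act_map K q G act g) = act_map K q G act (ginv G g)"
proof -
  let ?A = "fibre K q (gsrc G g)" and ?B = "fibre K q (grng G g)"
  let ?h = "restrict (act g) ?A"
  have sr: "gsrc G (ginv G g) = grng G g" "grng G (ginv G g) = gsrc G g"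
    using inv_inv[OF g] by (simp_all add: gsrc_def grng_def)
  have bh: "bij_betw ?h ?A ?B"
    using isometry_bij_betw[OF act_map_isometry[OF g]] by (simp add: act_map_def)
  have "restrict (inv_into ?A ?h) ?B y = restrict (act (ginv G g)) ?B y" for y
  proof (cases "y \<in> ?B")
    case True
    then obtain x where x: "x \<in> ?A" "y = act g x"
      using bij_betw_imp_surj_on[OF bh] by force
    then have "act (ginv G g) y = act (gmult G (ginv G g) g) x"
      using g inv_closed[OF g] sr by (simp add: act_mult fibre_def)
    also have "\<dots> = x"
      using act_unit[of "gsrc G g" x] x g by (simp add: gunits_def gsrc_def)
    finally show ?thesis
      using True x bij_betw_inv_into_left[OF bh x(1)] by simp
  qed simp
  then show ?thesis
    using sr by (auto simp: fibre_inverse_def act_map_def)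
qed

lemma enveloping_candidate_isometries: "enveloping_candidate K q G act isometries"
  unfolding enveloping_candidate_def
  using closedin_isometries fibre_comp_isometry act_map_isometry by blast

text \<open>Minimality of the enveloping semigroupoid is used twice: against all isometries, which gives
  compactness and bijectivity, and against the isometries with inverse in \<open>\<E>\<close>, which gives closure
  under inversion.\<close>

theorem enveloping_semigroupoid_compact_groupoid:
  "is_compact_groupoid K q G (uniform_enveloping_semigroupoid K q G act)"
proof -
  define \<E> where "\<E> = uniform_enveloping_semigroupoid K q G act"
  have Ecand: "enveloping_candidate K q G act \<E>"
    unfolding \<E>_def by (rule uniform_enveloping_semigroupoid_least)
  then have Ecl: "closedin \<C> \<E>"
    and Ecomp: "\<And>\<theta> \<eta>. \<theta> \<in> \<E> \<Longrightarrow> \<eta> \<in> \<E> \<Longrightarrow> frng \<eta> = fsrc \<theta> \<Longrightarrow> fibre_comp K q \<theta> \<eta> \<in> \<E>"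
    and Eact: "\<And>g. g \<in> garrows G \<Longrightarrow> act_map K q G act g \<in> \<E>"
    unfolding enveloping_candidate_def by blast+
  have EI: "\<E> \<subseteq> isometries"
    unfolding \<E>_def
    by (rule uniform_enveloping_semigroupoid_least(2)[OF enveloping_candidate_isometries])
  let ?S = "subtopology \<C> isometries"
  have "enveloping_candidate K q G act {\<theta> \<in> isometries. fibre_inverse K q \<theta> \<in> \<E>}"
    unfolding enveloping_candidate_def
  proof (intro conjI ballI impI)
    have "closedin ?S \<E>"
      using Ecl EI closedin_closed_subtopology[OF closedin_isometries] by blast
    from closedin_continuous_map_preimage[OF continuous_fibre_inverse this]
    moreover have "topspace ?S = isometries"
      using closedin_subset[OF closedin_isometries] by auto
    ultimately have "closedin ?S {\<theta> \<in> isometries. fibre_inverse K q \<theta> \<in> \<E>}"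
      by (simp only:)
    then show "closedin \<C> {\<theta> \<in> isometries. fibre_inverse K q \<theta> \<in> \<E>}"
      using closedin_closed_subtopology[OF closedin_isometries] by blast
  next
    fix \<theta> \<eta> assume t: "\<theta> \<in> {\<theta> \<in> isometries. fibre_inverse K q \<theta> \<in> \<E>}"
      and e: "\<eta> \<in> {\<theta> \<in> isometries. fibre_inverse K q \<theta> \<in> \<E>}" and c: "frng \<eta> = fsrc \<theta>"
    have "fibre_comp K q (fibre_inverse K q \<eta>) (fibre_inverse K q \<theta>) \<in> \<E>"
      using t e c by (intro Ecomp) (simp_all add: fibre_inverse_def)
    then show "fibre_comp K q \<theta> \<eta> \<in> {\<theta> \<in> isometries. fibre_inverse K q \<theta> \<in> \<E>}"
      using t e c fibre_comp_isometry fibre_inverse_comp by simp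
  next
    fix g assume "g \<in> garrows G"
    then show "act_map K q G act g \<in> {\<theta> \<in> isometries. fibre_inverse K q \<theta> \<in> \<E>}"
      using act_map_isometry fibre_inverse_act_map Eact inv_closed by simp
  qed
  then have Einv: "fibre_inverse K q \<theta> \<in> \<E>" if "\<theta> \<in> \<E>" for \<theta>
    using uniform_enveloping_semigroupoid_least(2) that unfolding \<E>_def by blast
  let ?T = "subtopology \<C> \<E>"
  have TS: "?T = subtopology ?S \<E>"
    using EI by (simp add: subtopology_subtopology Int_absorb1)
  have "compact_space ?T"
  proof -
    have "compactin \<C> isometries"
      unfolding compactin_subspace using compact_isometries closedin_subset[OF closedin_isometries]
      by blast
    then have "compactin \<C> \<E>" using closed_compactin[OF _ EI Ecl] by blast
    then show ?thesis by (simp add: compact_space_subtopology)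
  qed
  moreover have "Hausdorff_space ?T"
    by (rule Hausdorff_space_subtopology[OF Hausdorff_compact_open])
  moreover have "continuous_map ?T ?T (fibre_inverse K q)"
  proof -
    have "continuous_map ?T ?S (fibre_inverse K q)"
      unfolding TS by (rule continuous_map_from_subtopology[OF continuous_fibre_inverse])
    then show ?thesis
      unfolding TS[of ] continuous_map_in_subtopology[of _ ?S] using Einv by auto
  qed
  ultimately show ?thesis
    unfolding is_compact_groupoid_def Let_def \<E>_def[symmetric]
    using Einv isometry_bij_betw EI by blast
qed

end

section \<open>From a compact enveloping groupoid to invariant pseudometrics\<close>

locale compact_enveloping_groupoid = groupoid_action K q G act
  for K :: "'k topology" and q :: "'k \<Rightarrow> 'g" and G :: "'g groupoid_data"
    and act :: "'g \<Rightarrow> 'k \<Rightarrow> 'k" +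
  assumes ergodic: "topologically_ergodic G"
    and compact_groupoid:
      "is_compact_groupoid K q G (uniform_enveloping_semigroupoid K q G act)"
begin

abbreviation \<E> where "\<E> \<equiv> uniform_enveloping_semigroupoid K q G act"

lemma E_closed: "closedin \<C> \<E>"
  and E_comp: "\<theta> \<in> \<E> \<Longrightarrow> \<eta> \<in> \<E> \<Longrightarrow> frng \<eta> = fsrc \<theta> \<Longrightarrow> fibre_comp K q \<theta> \<eta> \<in> \<E>"
  and E_act: "g \<in> garrows G \<Longrightarrow> act_map K q G act g \<in> \<E>"
  using uniform_enveloping_semigroupoid_least(1) unfolding enveloping_candidate_def by blast+

lemma E_fibre_maps: "\<theta> \<in> \<E> \<Longrightarrow> \<theta> \<in> fibre_maps K q G"
  using closedin_subset[OF E_closed] by auto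

lemma fibre_maps_Int_E [simp]: "fibre_maps K q G \<inter> \<E> = \<E>"
  using E_fibre_maps by blast

lemma E_compact: "compact_space (subtopology \<C> \<E>)"
  and E_bij: "\<theta> \<in> \<E> \<Longrightarrow> bij_betw (ffun \<theta>) (fibre K q (fsrc \<theta>)) (fibre K q (frng \<theta>))"
  and E_inverse: "\<theta> \<in> \<E> \<Longrightarrow> fibre_inverse K q \<theta> \<in> \<E>"
  using compact_groupoid unfolding is_compact_groupoid_def Let_def by blast+

lemma E_unit:
  assumes "u \<in> gunits G"
  shows "\<exists>\<theta>\<in>\<E>. fsrc \<theta> = u \<and> frng \<theta> = u"
  using E_act[of u] assms gunits_subset src_rng_unit[OF assms]
  by (intro bexI[of _ "act_map K q G act u"]) (auto simp: act_map_def)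

text \<open>The relation of being joined by an element of \<open>\<E>\<close> is closed, as a continuous image of a
  compact space, so its quotient is a space to which ergodicity applies.\<close>

lemma E_transitive:
  assumes u: "u \<in> gunits G" and v: "v \<in> gunits G"
  obtains \<theta> where "\<theta> \<in> \<E>" "fsrc \<theta> = u" "frng \<theta> = v"
proof -
  define r where "r = (\<lambda>\<theta>. (fsrc \<theta>, frng \<theta>)) ` \<E>"
  have rI: "(fsrc \<theta>, frng \<theta>) \<in> r" if "\<theta> \<in> \<E>" for \<theta>
    using that by (auto simp: r_def)
  have "continuous_map (subtopology \<C> \<E>) (prod_topology (unit_space G) (unit_space G))
      (\<lambda>\<theta>. (fsrc \<theta>, frng \<theta>))"
    by (intro continuous_map_pairedI continuous_map_from_subtopology continuous_fsrc continuous_frng)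
  from image_compactin[OF _ this, of \<E>] E_compact
  have "compactin (prod_topology (unit_space G) (unit_space G)) r"
    by (simp add: r_def compact_space_def)
  then have cl: "closedin (prod_topology (unit_space G) (unit_space G)) r"
    using Hausdorff_unit_space by (intro compactin_imp_closedin) (simp_all add: Hausdorff_space_prod_topology)
  have eq: "equiv (topspace (unit_space G)) r"
  proof (rule equivI)
    show "r \<subseteq> topspace (unit_space G) \<times> topspace (unit_space G)"
      using closedin_subset[OF cl] by simp
    show "refl_on (topspace (unit_space G)) r"
      unfolding refl_on_def using E_unit rI by fastforce
    show "sym r"
    proof (rule symI)
      fix a b assume "(a, b) \<in> r"
      then obtain \<theta> where "\<theta> \<in> \<E>" "a = fsrc \<theta>" "b = frng \<theta>" by (auto simp: r_def)
      then show "(b, a) \<in> r"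
        using rI[OF E_inverse] by (simp add: fibre_inverse_def)
    qed
    show "trans r"
    proof (rule transI)
      fix a b c assume "(a, b) \<in> r" "(b, c) \<in> r"
      then obtain \<theta> \<eta> where "\<theta> \<in> \<E>" "a = fsrc \<theta>" "b = frng \<theta>" "\<eta> \<in> \<E>" "b = fsrc \<eta>" "c = frng \<eta>"
        by (auto simp: r_def)
      then show "(a, c) \<in> r"
        using rI[OF E_comp, of \<eta> \<theta>] by (simp add: fibre_comp_def)
    qed
  qed
  obtain M :: "'g set topology" where M: "compact_space M" "Hausdorff_space M"
    "continuous_map (unit_space G) M (\<lambda>x. r `` {x})"
    "(\<lambda>x. r `` {x}) ` topspace (unit_space G) = topspace M"
    using compact_Hausdorff_quotient[OF compact_unit_space Hausdorff_unit_space eq cl] .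
  have "r `` {gsrc G g} = r `` {grng G g}" if "g \<in> garrows G" for g
    using rI[OF E_act[OF that]] by (intro equiv_class_eq[OF eq]) (simp add: act_map_def)
  from topologically_ergodic_any_type[OF ergodic M this]
  obtain m where "topspace M = {m}" by blast
  then have "r `` {u} = r `` {v}"
    using M(4) u v by (metis (no_types, lifting) image_eqI singletonD topspace_unit_space)
  then have "(u, v) \<in> r"
    using eq_equiv_class_iff[OF eq] u v by simp
  then show ?thesis using that by (auto simp: r_def)
qed

text \<open>For an empty unit space the empty space would be an invariant quotient that is not a point.\<close>

lemma units_nonempty: "\<exists>u. u \<in> gunits G"
proof (rule ccontr)
  assume "\<nexists>u. u \<in> gunits G"
  then have none: "gunits G = {}" by blast
  then have "garrows G = {}" by (simp add: gunits_def)
  then have "\<exists>m. topspace (trivial_topology :: 'g topology) = {m}"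
    using none by (intro topologically_ergodic_any_type[OF ergodic, of trivial_topology id])
      (auto simp: continuous_map_def)
  then show False by simp
qed

definition base where "base = (SOME u. u \<in> gunits G)"

lemma base_unit: "base \<in> gunits G"
  unfolding base_def by (rule someI_ex[OF units_nonempty])

definition to_base :: "'k \<Rightarrow> ('g, 'k) fibre_map set" where
  "to_base x = {\<theta> \<in> \<E>. fsrc \<theta> = q x \<and> frng \<theta> = base}"

lemma to_base_nonempty: "x \<in> topspace K \<Longrightarrow> to_base x \<noteq> {}"
  using E_transitive[OF q_in_gunits base_unit] unfolding to_base_def by blast

definition pairs where "pairs = subtopology (prod_topology K K) {(x, y). q x = q y}"

lemma mem_pairs: "(x, y) \<in> topspace pairs \<longleftrightarrow> x \<in> topspace K \<and> y \<in> topspace K \<and> q x = q y"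
  by (auto simp: pairs_def)

text \<open>The triples \<open>(\<theta>, x, y)\<close> in question form a closed subset of \<open>\<E> \<times> K \<times> K\<close>, by joint
  continuity of evaluation, and the projection along the compact space \<open>\<E>\<close> is a closed map.\<close>

lemma closedin_transported:
  assumes F: "closedin (prod_topology K K) F"
  shows "closedin pairs {z \<in> topspace pairs. \<exists>\<theta>\<in>to_base (fst z). (ffun \<theta> (fst z), ffun \<theta> (snd z)) \<in> F}"
proof -
  let ?T = "subtopology \<C> \<E>" and ?KK = "prod_topology K K"
  let ?Z = "prod_topology ?T ?KK"
  define D where "D = {z \<in> topspace ?Z. fsrc (fst z) = q (fst (snd z))} \<inter>
      {z \<in> topspace ?Z. fsrc (fst z) = q (snd (snd z))} \<inter> {z \<in> topspace ?Z. frng (fst z) = base}"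
  have cfst: "continuous_map ?Z \<C> fst"
    using continuous_map_fst[of ?T ?KK] by (simp add: continuous_map_in_subtopology)
  have c1: "continuous_map ?Z K (\<lambda>z. fst (snd z))" and c2: "continuous_map ?Z K (\<lambda>z. snd (snd z))"
    using continuous_map_compose[OF continuous_map_snd continuous_map_fst, of ?T K K]
      continuous_map_compose[OF continuous_map_snd continuous_map_snd, of ?T K K]
    by (simp_all add: o_def)
  have clD: "closedin ?Z D"
    unfolding D_def
  proof (intro closedin_Int)
    have s: "continuous_map ?Z (unit_space G) (\<lambda>z. fsrc (fst z))"
      using continuous_map_compose[OF cfst continuous_fsrc] by (simp add: o_def)
    have q1: "continuous_map ?Z (unit_space G) (\<lambda>z. q (fst (snd z)))"
      using continuous_map_compose[OF c1 continuous_q] by (simp add: o_def)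
    have q2: "continuous_map ?Z (unit_space G) (\<lambda>z. q (snd (snd z)))"
      using continuous_map_compose[OF c2 continuous_q] by (simp add: o_def)
    have r: "continuous_map ?Z (unit_space G) (\<lambda>z. frng (fst z))"
      using continuous_map_compose[OF cfst continuous_frng] by (simp add: o_def)
    have b: "continuous_map ?Z (unit_space G) (\<lambda>z. base)"
      using base_unit by simp
    show "closedin ?Z {z \<in> topspace ?Z. fsrc (fst z) = q (fst (snd z))}"
      by (rule closedin_continuous_maps_eq[OF Hausdorff_unit_space s q1])
    show "closedin ?Z {z \<in> topspace ?Z. fsrc (fst z) = q (snd (snd z))}"
      by (rule closedin_continuous_maps_eq[OF Hausdorff_unit_space s q2])
    show "closedin ?Z {z \<in> topspace ?Z. frng (fst z) = base}"
      by (rule closedin_continuous_maps_eq[OF Hausdorff_unit_space r b])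
  qed
  let ?ZD = "subtopology ?Z D"
  have ev: "continuous_map ?ZD K (\<lambda>z. ffun (fst z) (k z))"
    if k: "continuous_map ?Z K k" and kD: "\<And>z. z \<in> D \<Longrightarrow> fsrc (fst z) = q (k z)" for k
  proof -
    have "continuous_map ?ZD (prod_topology \<C> K) (\<lambda>z. (fst z, k z))"
      by (intro continuous_map_pairedI continuous_map_from_subtopology cfst k)
    then have "continuous_map ?ZD (subtopology (prod_topology \<C> K) {(\<theta>, x). fsrc \<theta> = q x})
        (\<lambda>z. (fst z, k z))"
      unfolding continuous_map_in_subtopology using kD by auto
    from continuous_map_compose[OF this continuous_eval] show ?thesis by (simp add: o_def)
  qed
  have "continuous_map ?ZD ?KK (\<lambda>z. (ffun (fst z) (fst (snd z)), ffun (fst z) (snd (snd z))))"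
    by (intro continuous_map_pairedI ev c1 c2) (unfold D_def, blast+)
  from closedin_continuous_map_preimage[OF this F]
  have "closedin ?Z {z \<in> topspace ?ZD. (ffun (fst z) (fst (snd z)), ffun (fst z) (snd (snd z))) \<in> F}"
    using closedin_trans_full clD by blast
  then have "closedin ?KK (snd ` {z \<in> topspace ?ZD.
      (ffun (fst z) (fst (snd z)), ffun (fst z) (snd (snd z))) \<in> F})" (is "closedin _ ?A")
    using closed_map_snd[OF E_compact, of ?KK] unfolding closed_map_def by blast
  moreover have "?A = {z \<in> topspace pairs. \<exists>\<theta>\<in>to_base (fst z). (ffun \<theta> (fst z), ffun \<theta> (snd z)) \<in> F}"
    (is "_ = ?B")
  proof
    show "?A \<subseteq> ?B" by (auto simp: D_def pairs_def to_base_def)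
    show "?B \<subseteq> ?A"
    proof
      fix z assume "z \<in> ?B"
      then obtain \<theta> where \<theta>: "z \<in> topspace pairs" "\<theta> \<in> to_base (fst z)"
        "(ffun \<theta> (fst z), ffun \<theta> (snd z)) \<in> F" by blast
      then show "z \<in> ?A"
        using E_fibre_maps
        by (intro image_eqI[of _ _ "(\<theta>, z)"]) (auto simp: D_def pairs_def to_base_def)
    qed
  qed
  ultimately have "closedin ?KK ?B" by (simp only:)
  moreover have "?B \<subseteq> {(x, y). q x = q y}" by (auto simp: pairs_def)
  ultimately show ?thesis
    unfolding pairs_def by (rule closedin_subset_topspace)
qed

text \<open>Moving \<open>x\<close> and \<open>y\<close> to the base fibre in all possible ways makes the distance invariant.
  The value is meaningful only for pairs in a common fibre, since \<open>to_base\<close> depends on \<open>x\<close> alone.\<close>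

definition sup_dist :: "('k \<Rightarrow> real) \<Rightarrow> 'k \<times> 'k \<Rightarrow> real" where
  "sup_dist f = (\<lambda>(x, y). SUP \<theta>\<in>to_base x. \<bar>f (ffun \<theta> x) - f (ffun \<theta> y)\<bar>)"

context
  fixes f :: "'k \<Rightarrow> real"
  assumes f: "continuous_map K euclideanreal f"
begin

lemma bdd_sup_dist:
  assumes "(x, y) \<in> topspace pairs"
  shows "bdd_above ((\<lambda>\<theta>. \<bar>f (ffun \<theta> x) - f (ffun \<theta> y)\<bar>) ` to_base x)"
proof -
  have "compact (f ` topspace K)"
    using image_compactin[OF _ f, of "topspace K"] compact_K by (simp add: compact_space_def)
  then obtain B where B: "\<And>z. z \<in> topspace K \<Longrightarrow> \<bar>f z\<bar> \<le> B"
    using compact_imp_bounded bounded_iff by (metis imageI real_norm_def)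
  have "\<bar>f (ffun \<theta> x) - f (ffun \<theta> y)\<bar> \<le> B + B" if "\<theta> \<in> to_base x" for \<theta>
  proof -
    have "ffun \<theta> x \<in> topspace K" "ffun \<theta> y \<in> topspace K"
      using fibre_mapsD(5)[OF E_fibre_maps, of \<theta>] that assms
      by (auto simp: to_base_def mem_pairs fibre_def)
    from B[OF this(1)] B[OF this(2)] show ?thesis by linarith
  qed
  then show ?thesis by (auto simp: bdd_above_def)
qed

lemma sup_dist_upper:
  assumes "(x, y) \<in> topspace pairs" "\<theta> \<in> to_base x"
  shows "\<bar>f (ffun \<theta> x) - f (ffun \<theta> y)\<bar> \<le> sup_dist f (x, y)"
  unfolding sup_dist_def by (simp, rule cSUP_upper[OF assms(2) bdd_sup_dist[OF assms(1)]])

lemma sup_dist_least: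
  assumes "(x, y) \<in> topspace pairs"
    and "\<And>\<theta>. \<theta> \<in> to_base x \<Longrightarrow> \<bar>f (ffun \<theta> x) - f (ffun \<theta> y)\<bar> \<le> c"
  shows "sup_dist f (x, y) \<le> c"
  unfolding sup_dist_def using assms to_base_nonempty by (simp add: mem_pairs cSUP_least)

lemma sup_dist_nonneg:
  assumes "(x, y) \<in> topspace pairs" shows "0 \<le> sup_dist f (x, y)"
proof -
  obtain \<theta> where "\<theta> \<in> to_base x" using to_base_nonempty assms by (auto simp: mem_pairs)
  from sup_dist_upper[OF assms this] show ?thesis by linarith
qed

lemma sup_dist_pseudometric:
  assumes u: "u \<in> gunits G"
  shows "pseudometric_on (fibre K q u) (sup_dist f)"
  unfolding pseudometric_on_def
proof (intro conjI ballI)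
  have m: "(x, y) \<in> topspace pairs" if "x \<in> fibre K q u" "y \<in> fibre K q u" for x y
    using that by (simp add: mem_pairs fibre_def)
  have tb: "to_base x = to_base y" if "x \<in> fibre K q u" "y \<in> fibre K q u" for x y
    using that by (simp add: to_base_def fibre_def)
  fix x assume x: "x \<in> fibre K q u"
  show "sup_dist f (x, x) = 0"
    using sup_dist_least[OF m[OF x x], of 0] sup_dist_nonneg[OF m[OF x x]] by simp
  fix y assume y: "y \<in> fibre K q u"
  show "0 \<le> sup_dist f (x, y)" using sup_dist_nonneg[OF m[OF x y]] .
  show "sup_dist f (x, y) = sup_dist f (y, x)"
    unfolding sup_dist_def using tb[OF x y] by (simp add: abs_minus_commute)
  fix z assume z: "z \<in> fibre K q u"
  show "sup_dist f (x, z) \<le> sup_dist f (x, y) + sup_dist f (y, z)"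
  proof (rule sup_dist_least[OF m[OF x z]])
    fix \<theta> assume t: "\<theta> \<in> to_base x"
    have "\<bar>f (ffun \<theta> x) - f (ffun \<theta> y)\<bar> \<le> sup_dist f (x, y)"
      by (rule sup_dist_upper[OF m[OF x y] t])
    moreover have "\<bar>f (ffun \<theta> y) - f (ffun \<theta> z)\<bar> \<le> sup_dist f (y, z)"
      by (rule sup_dist_upper[OF m[OF y z]]) (use t tb[OF x y] in simp)
    ultimately show "\<bar>f (ffun \<theta> x) - f (ffun \<theta> z)\<bar> \<le> sup_dist f (x, y) + sup_dist f (y, z)"
      by linarith
  qed
qed

text \<open>Precomposition with the map of \<open>g\<close> turns an element that moves \<open>g x\<close> to the base fibre into
  one that moves \<open>x\<close> there, so the supremum for \<open>(g x, g y)\<close> is taken over a smaller set.\<close>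

lemma sup_dist_act_le:
  assumes g: "g \<in> garrows G" and x: "x \<in> fibre K q (gsrc G g)" and y: "y \<in> fibre K q (gsrc G g)"
  shows "sup_dist f (act g x, act g y) \<le> sup_dist f (x, y)"
proof -
  have m: "(x, y) \<in> topspace pairs" using x y by (simp add: mem_pairs fibre_def)
  have gx: "act g x \<in> fibre K q (grng G g)" "act g y \<in> fibre K q (grng G g)"
    using fibre_mapsD(5)[OF act_map_in_fibre_maps[OF g]] x y by (auto simp: act_map_def)
  then have gm: "(act g x, act g y) \<in> topspace pairs" by (simp add: mem_pairs fibre_def)
  show ?thesis
  proof (rule sup_dist_least[OF gm])
    fix \<theta> assume t: "\<theta> \<in> to_base (act g x)"
    let ?\<eta> = "fibre_comp K q \<theta> (act_map K q G act g)"
    have "?\<eta> \<in> to_base x"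
      using t gx x g E_comp[OF _ E_act[OF g], of \<theta>]
      by (auto simp: to_base_def fibre_comp_def act_map_def fibre_def)
    from sup_dist_upper[OF m this]
    show "\<bar>f (ffun \<theta> (act g x)) - f (ffun \<theta> (act g y))\<bar> \<le> sup_dist f (x, y)"
      using x y by (simp add: fibre_comp_def act_map_def compose_def)
  qed
qed

lemma sup_dist_invariant:
  assumes g: "g \<in> garrows G" and x: "x \<in> fibre K q (gsrc G g)" and y: "y \<in> fibre K q (gsrc G g)"
  shows "sup_dist f (act g x, act g y) = sup_dist f (x, y)"
proof (rule antisym[OF sup_dist_act_le[OF assms]])
  have sr: "gsrc G (ginv G g) = grng G g" "grng G (ginv G g) = gsrc G g"
    using inv_inv[OF g] by (simp_all add: gsrc_def grng_def)
  have gx: "act g x \<in> fibre K q (grng G g)" "act g y \<in> fibre K q (grng G g)"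
    using fibre_mapsD(5)[OF act_map_in_fibre_maps[OF g]] x y by (auto simp: act_map_def)
  have cancel: "act (ginv G g) (act g z) = z" if "z \<in> fibre K q (gsrc G g)" for z
  proof -
    have "act (ginv G g) (act g z) = act (gmult G (ginv G g) g) z"
      using g inv_closed[OF g] sr that by (simp add: act_mult fibre_def)
    also have "\<dots> = z"
      using act_unit[of "gsrc G g" z] that g by (simp add: gunits_def gsrc_def)
    finally show ?thesis .
  qed
  show "sup_dist f (x, y) \<le> sup_dist f (act g x, act g y)"
    using sup_dist_act_le[OF inv_closed[OF g], of "act g x" "act g y"] gx
    by (simp add: sr cancel x y)
qed

text \<open>This set consists of the pairs in the base fibre whose images under the whole isotropy group
  are \<open>c\<close>-close under \<open>f\<close>; it is an intersection of closed sets, one for each isotropy element.\<close>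

lemma closedin_base_diff_le:
  "closedin (prod_topology K K) {z \<in> fibre K q base \<times> fibre K q base.
     \<forall>h\<in>\<E>. fsrc h = base \<and> frng h = base \<longrightarrow> \<bar>f (ffun h (fst z)) - f (ffun h (snd z))\<bar> \<le> c}"
proof -
  let ?B = "fibre K q base" and ?FB = "fibre_space K q base"
  let ?H = "{h \<in> \<E>. fsrc h = base \<and> frng h = base}"
  let ?C = "\<lambda>h. {z \<in> ?B \<times> ?B. \<bar>f (ffun h (fst z)) - f (ffun h (snd z))\<bar> \<le> c}"
  have BB: "closedin (prod_topology K K) (?B \<times> ?B)"
    using closedin_fibre[OF base_unit] by (simp add: closedin_prod_Times_iff)
  have "closedin (prod_topology K K) (?C h)" if h: "h \<in> ?H" for h
  proof -
    have "continuous_map ?FB ?FB (ffun h)"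
      using fibre_mapsD(4)[OF E_fibre_maps, of h] h by simp
    then have "continuous_map ?FB K (ffun h)"
      unfolding fibre_space_def[of K q base] continuous_map_in_subtopology by blast
    from continuous_map_compose[OF this f]
    have fh: "continuous_map ?FB euclideanreal (f \<circ> ffun h)" .
    have "continuous_map (prod_topology ?FB ?FB) euclideanreal
        (\<lambda>z. \<bar>f (ffun h (fst z)) - f (ffun h (snd z))\<bar>)"
      using continuous_map_compose[OF continuous_map_fst fh, of ?FB]
        continuous_map_compose[OF continuous_map_snd fh, of ?FB]
      by (intro continuous_map_real_abs continuous_map_diff) (simp_all add: o_def)
    from closedin_continuous_map_preimage[OF this, of "{..c}"]
    have "closedin (prod_topology ?FB ?FB) (?C h)" by simp
    then show ?thesis
      using closedin_trans_full[OF _ BB, of "?C h"]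
      by (simp add: subtopology_Times fibre_space_def)
  qed
  moreover have "?H \<noteq> {}" using E_unit[OF base_unit] by blast
  ultimately have "closedin (prod_topology K K) (\<Inter>h\<in>?H. ?C h)"
    by (intro closedin_INT) auto
  moreover have "(\<Inter>h\<in>?H. ?C h) = {z \<in> ?B \<times> ?B.
     \<forall>h\<in>\<E>. fsrc h = base \<and> frng h = base \<longrightarrow> \<bar>f (ffun h (fst z)) - f (ffun h (snd z))\<bar> \<le> c}"
    using \<open>?H \<noteq> {}\<close> by auto
  ultimately show ?thesis by simp
qed

text \<open>The upper bound quantifies over all \<open>\<theta>\<close>, but closedness needs an existential statement. All
  elements from the fibre of \<open>x\<close> to the base fibre are of the form \<open>h \<circ> \<theta>\<close> with one fixed \<open>\<theta>\<close> and
  \<open>h\<close> in the isotropy group, so a single \<open>\<theta>\<close> decides.\<close>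

lemma sup_dist_le_iff:
  assumes xy: "(x, y) \<in> topspace pairs"
  shows "sup_dist f (x, y) \<le> c \<longleftrightarrow>
    (\<exists>\<theta>\<in>to_base x. (ffun \<theta> x, ffun \<theta> y) \<in> {z \<in> fibre K q base \<times> fibre K q base.
     \<forall>h\<in>\<E>. fsrc h = base \<and> frng h = base \<longrightarrow> \<bar>f (ffun h (fst z)) - f (ffun h (snd z))\<bar> \<le> c})"
    (is "_ \<longleftrightarrow> ?r")
proof
  have x: "x \<in> fibre K q (q x)" "y \<in> fibre K q (q x)" using xy by (auto simp: mem_pairs fibre_def)
  have img: "ffun \<theta> x \<in> fibre K q base" "ffun \<theta> y \<in> fibre K q base" if "\<theta> \<in> to_base x" for \<theta>
    using fibre_mapsD(5)[OF E_fibre_maps, of \<theta>] that x by (auto simp: to_base_def)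
  show "?r" if le: "sup_dist f (x, y) \<le> c"
  proof -
    obtain \<theta> where t: "\<theta> \<in> to_base x" using to_base_nonempty xy by (auto simp: mem_pairs)
    have "\<bar>f (ffun h (ffun \<theta> x)) - f (ffun h (ffun \<theta> y))\<bar> \<le> c"
      if h: "h \<in> \<E>" "fsrc h = base" "frng h = base" for h
    proof -
      have "fibre_comp K q h \<theta> \<in> to_base x"
        using E_comp[of h \<theta>] t h by (simp add: to_base_def fibre_comp_def)
      from sup_dist_upper[OF xy this] le t x show ?thesis
        by (simp add: fibre_comp_def compose_def to_base_def)
    qed
    with t img[OF t] show ?thesis by (intro bexI[of _ \<theta>]) simp_all
  qed
  assume ?r
  then obtain \<theta> where t: "\<theta> \<in> to_base x"
    and le: "\<And>h. h \<in> \<E> \<Longrightarrow> fsrc h = base \<Longrightarrow> frng h = base \<Longrightarrow>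
      \<bar>f (ffun h (ffun \<theta> x)) - f (ffun h (ffun \<theta> y))\<bar> \<le> c" by auto
  show "sup_dist f (x, y) \<le> c"
  proof (rule sup_dist_least[OF xy])
    fix \<eta> assume e: "\<eta> \<in> to_base x"
    let ?h = "fibre_comp K q \<eta> (fibre_inverse K q \<theta>)"
    have h: "?h \<in> \<E>" "fsrc ?h = base" "frng ?h = base"
      using E_comp[OF _ E_inverse, of \<eta> \<theta>] e t
      by (simp_all add: to_base_def fibre_comp_def fibre_inverse_def)
    have "ffun ?h (ffun \<theta> z) = ffun \<eta> z" if "z \<in> fibre K q (q x)" "ffun \<theta> z \<in> fibre K q base" for z
      using that t bij_betw_inv_into_left[OF E_bij, of \<theta> z]
      by (simp add: fibre_comp_def fibre_inverse_def compose_def to_base_def)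
    then show "\<bar>f (ffun \<eta> x) - f (ffun \<eta> y)\<bar> \<le> c"
      using le[OF h] x img[OF t] by simp
  qed
qed

text \<open>Both half-line preimages are closed: \<open>{p \<le> c}\<close> by the isotropy description above, and
  \<open>{p \<ge> c}\<close> as the intersection over \<open>b < c\<close> of the sets where some \<open>\<theta>\<close> attains at least \<open>b\<close>,
  which avoids the question whether the supremum is attained.\<close>

lemma continuous_sup_dist: "continuous_map pairs (top_of_set {0..}) (sup_dist f)"
  unfolding continuous_map_upper_lower_semicontinuous_le_gen
proof (intro conjI allI ballI)
  show "sup_dist f z \<in> {0..}" if "z \<in> topspace pairs" for z
    using sup_dist_nonneg that by (cases z) simp
  fix c
  let ?L = "{z \<in> fibre K q base \<times> fibre K q base.
     \<forall>h\<in>\<E>. fsrc h = base \<and> frng h = base \<longrightarrow> \<bar>f (ffun h (fst z)) - f (ffun h (snd z))\<bar> \<le> c}"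
  have "sup_dist f z \<le> c \<longleftrightarrow> (\<exists>\<theta>\<in>to_base (fst z). (ffun \<theta> (fst z), ffun \<theta> (snd z)) \<in> ?L)"
    if "z \<in> topspace pairs" for z
    using sup_dist_le_iff[of "fst z" "snd z" c] that by (simp only: prod.collapse)
  then have "{z \<in> topspace pairs. sup_dist f z \<le> c} =
      {z \<in> topspace pairs. \<exists>\<theta>\<in>to_base (fst z). (ffun \<theta> (fst z), ffun \<theta> (snd z)) \<in> ?L}"
    by (intro Collect_cong conj_cong refl)
  then show "closedin pairs {z \<in> topspace pairs. sup_dist f z \<le> c}"
    using closedin_transported[OF closedin_base_diff_le] by (simp only:)
  let ?F = "\<lambda>b. {z \<in> topspace (prod_topology K K). b \<le> \<bar>f (fst z) - f (snd z)\<bar>}"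
  let ?A = "\<lambda>b. {z \<in> topspace pairs. \<exists>\<theta>\<in>to_base (fst z). (ffun \<theta> (fst z), ffun \<theta> (snd z)) \<in> ?F b}"
  have "closedin (prod_topology K K) (?F b)" for b
  proof -
    have "continuous_map (prod_topology K K) euclideanreal (\<lambda>z. \<bar>f (fst z) - f (snd z)\<bar>)"
      using continuous_map_compose[OF continuous_map_fst f, of K]
        continuous_map_compose[OF continuous_map_snd f, of K]
      by (intro continuous_map_real_abs continuous_map_diff) (simp_all add: o_def)
    from closedin_continuous_map_preimage[OF this, of "{b..}"] show ?thesis by simp
  qed
  then have clA: "closedin pairs (?A b)" for b by (rule closedin_transported)
  have "{..<c} \<noteq> {}" using lt_ex[of c] by blast
  then have "closedin pairs (\<Inter>b\<in>{..<c}. ?A b)"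
    using clA by (rule closedin_INT)
  moreover have "(\<Inter>b\<in>{..<c}. ?A b) = {z \<in> topspace pairs. c \<le> sup_dist f z}"
  proof -
    have ge_iff: "(\<forall>b<c. (x, y) \<in> ?A b) \<longleftrightarrow> c \<le> sup_dist f (x, y)" if xy: "(x, y) \<in> topspace pairs" for x y
    proof
      assume a: "\<forall>b<c. (x, y) \<in> ?A b"
      show "c \<le> sup_dist f (x, y)"
      proof (rule dense_le)
        fix b assume "b < c"
        then obtain \<theta> where "\<theta> \<in> to_base x" "b \<le> \<bar>f (ffun \<theta> x) - f (ffun \<theta> y)\<bar>"
          using a by auto
        with sup_dist_upper[OF xy] show "b \<le> sup_dist f (x, y)" by force
      qed
    next
      assume le: "c \<le> sup_dist f (x, y)"
      show "\<forall>b<c. (x, y) \<in> ?A b"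
      proof (intro allI impI)
        fix b assume "b < c"
        then have "\<not> sup_dist f (x, y) \<le> b" using le by simp
        then obtain \<theta> where t: "\<theta> \<in> to_base x" "b \<le> \<bar>f (ffun \<theta> x) - f (ffun \<theta> y)\<bar>"
          using sup_dist_least[OF xy, of b] by force
        have "ffun \<theta> x \<in> topspace K" "ffun \<theta> y \<in> topspace K"
          using fibre_mapsD(5)[OF E_fibre_maps, of \<theta>] t(1) xy
          by (auto simp: to_base_def mem_pairs fibre_def)
        with t xy show "(x, y) \<in> ?A b" by (auto intro!: bexI[of _ \<theta>])
      qed
    qed
    show ?thesis
    proof (rule set_eqI)
      fix z
      have "z \<in> topspace pairs" if "\<forall>b<c. z \<in> ?A b"
        using that lt_ex[of c] by blast
      then have "(\<forall>b<c. z \<in> ?A b) \<longleftrightarrow> z \<in> topspace pairs \<and> c \<le> sup_dist f z"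
        using ge_iff[of "fst z" "snd z"] unfolding prod.collapse by blast
      then show "z \<in> (\<Inter>b\<in>{..<c}. ?A b) \<longleftrightarrow> z \<in> {z \<in> topspace pairs. c \<le> sup_dist f z}"
        by (simp only: INT_iff Ball_def lessThan_iff mem_Collect_eq)
    qed
  qed
  ultimately show "closedin pairs {z \<in> topspace pairs. c \<le> sup_dist f z}" by (simp only:)
qed

end

text \<open>An element of \<open>\<E>\<close> keeps the two points apart in the base fibre, where a Urysohn function of
  \<open>K\<close> distinguishes them.\<close>

lemma sup_dist_separates:
  assumes u: "u \<in> gunits G" and x: "x \<in> fibre K q u" and y: "y \<in> fibre K q u" and ne: "x \<noteq> y"
  shows "\<exists>f. continuous_map K euclideanreal f \<and> sup_dist f (x, y) > 0"
proof -
  have xy: "(x, y) \<in> topspace pairs" using x y by (simp add: mem_pairs fibre_def)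
  obtain \<theta> where t: "\<theta> \<in> to_base x" using to_base_nonempty xy by (auto simp: mem_pairs)
  have tE: "\<theta> \<in> \<E>" "fsrc \<theta> = u" using t x by (auto simp: to_base_def fibre_def)
  have im: "ffun \<theta> x \<in> topspace K" "ffun \<theta> y \<in> topspace K"
    using fibre_mapsD(5)[OF E_fibre_maps[OF tE(1)]] tE(2) x y by (auto simp: fibre_def)
  have "ffun \<theta> x \<noteq> ffun \<theta> y"
    using bij_betw_imp_inj_on[OF E_bij[OF tE(1)]] tE(2) x y ne by (auto dest: inj_onD)
  moreover have "completely_regular_space K"
    using compact_K Hausdorff_K
    by (meson compact_Hausdorff_or_regular_imp_normal_space normal_imp_completely_regular_space)
  moreover have "closedin K {ffun \<theta> y}"
    using im Hausdorff_K by (simp add: closedin_Hausdorff_sing_eq)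
  ultimately obtain f :: "'k \<Rightarrow> real" where f: "continuous_map K (top_of_set {0..1}) f"
    "f (ffun \<theta> x) = 0" "f ` {ffun \<theta> y} \<subseteq> {1}"
    using im(1) unfolding completely_regular_space_def by (metis Diff_iff singletonD)
  have fc: "continuous_map K euclideanreal f"
    using f(1) by (simp add: continuous_map_in_subtopology)
  have "1 \<le> sup_dist f (x, y)"
    using sup_dist_upper[OF fc xy t] f(2,3) by simp
  with fc show ?thesis by (intro exI[of _ f]) simp
qed

theorem enveloping_groupoid_pseudoisometric: "pseudoisometric K q G act"
proof -
  let ?P = "{sup_dist f | f. continuous_map K euclideanreal f}"
  have cont: "continuous_map pairs (top_of_set {0..}) p" if "p \<in> ?P" for p
    using that continuous_sup_dist by blast
  have pm: "pseudometric_on (fibre K q u) p" if "p \<in> ?P" "u \<in> gunits G" for p u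
    using that sup_dist_pseudometric by blast
  have top: "pseudometric_topology (fibre K q u) ?P = fibre_space K q u" if u: "u \<in> gunits G" for u
  proof -
    let ?Y = "fibre_space K q u"
    have YY: "prod_topology ?Y ?Y = subtopology pairs (fibre K q u \<times> fibre K q u)"
    proof -
      have "{(x, y). q x = q y} \<inter> fibre K q u \<times> fibre K q u = fibre K q u \<times> fibre K q u"
        by (auto simp: fibre_def)
      then show ?thesis
        by (simp add: pairs_def subtopology_subtopology fibre_space_def subtopology_Times)
    qed
    have "pseudometric_topology (topspace ?Y) ?P = ?Y"
    proof (rule pseudometric_topology_eq_compact[OF compact_fibre_space[OF u]])
      fix p assume p: "p \<in> ?P"
      show "continuous_map (prod_topology ?Y ?Y) euclideanreal p"
        unfolding YY using cont[OF p]
        by (intro continuous_map_from_subtopology) (simp add: continuous_map_in_subtopology)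
      show "pseudometric_on (topspace ?Y) p" using pm[OF p u] by simp
    next
      fix x y assume "x \<in> topspace ?Y" "y \<in> topspace ?Y" "x \<noteq> y"
      then show "\<exists>p\<in>?P. p (x, y) > 0" using sup_dist_separates[OF u, of x y] by auto
    qed
    then show ?thesis by simp
  qed
  show ?thesis
    unfolding pseudoisometric_def
    using cont pm top sup_dist_invariant unfolding pairs_def
    by (intro exI[of _ ?P] conjI ballI) blast+
qed

end

theorem theorem3p27:
  fixes K :: "'k topology" and q :: "'k \<Rightarrow> 'g" and G :: "'g groupoid_data"
    and act :: "'g \<Rightarrow> 'k \<Rightarrow> 'k"
  assumes "groupoid_action K q G act"
    and "topologically_ergodic G"
  shows "pseudoisometric K q G act \<longleftrightarrow>
         is_compact_groupoid K q G (uniform_enveloping_semigroupoid K q G act)"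
proof
  assume "pseudoisometric K q G act"
  then obtain P where "invariant_pseudometrics K q G act P"
    using assms(1) unfolding pseudoisometric_def invariant_pseudometrics_def
      invariant_pseudometrics_axioms_def by metis
  then show "is_compact_groupoid K q G (uniform_enveloping_semigroupoid K q G act)"
    by (rule invariant_pseudometrics.enveloping_semigroupoid_compact_groupoid)
next
  assume "is_compact_groupoid K q G (uniform_enveloping_semigroupoid K q G act)"
  then have "compact_enveloping_groupoid K q G act"
    using assms by (simp add: compact_enveloping_groupoid_def compact_enveloping_groupoid_axioms_def)
  then show "pseudoisometric K q G act"
    by (rule compact_enveloping_groupoid.enveloping_groupoid_pseudoisometric)
qed

end
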